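(* Let $R$ be a unique factorization domain, let $P,Q\in R$ with $Q\in R^{\times}$, $f(t)=t^2-Pt+Q$ with roots $\theta_1,\theta_2$ in an algebraic closure of the fraction field of $R$, and $d=P^2-4Q$. Let $V_f(R)=R^2$ (column vectors $(a_1,a_0)^T$) with the $R$-algebra structure transported from $\mathcal O_R=R[t]/(f(t))$ via $(a_1,a_0)^T\mapsto a_1-a_0t$, let $V_f(R)^{\times}$ be its unit group, i.e. $\{(a_1,a_0)^T:\ a_1^2-Pa_0a_1+Qa_0^2\in R^{\times}\}$, and let $\mathscr S(f,R)^{\times}$ be the group of sequences $(w_n)_{n\in\mathbb Z}$ in $R$ with $w_{n+2}-Pw_{n+1}+Qw_n=0$ and $(w_1,w_0)^T\in V_f(R)^{\times}$, with group structure transported via $(w_n)\mapsto (w_1,w_0)^T$. (1) If $f$ is irreducible over $R$, then $\psi_R:V_f(R)\to R[\theta_1]$, $(a_1,a_0)^T\mapsto a_1-a_0\theta_1$, is an isomorphism of $R$-algebras, giving group isomorphisms $\mathscr S(f,R)^{\times}\simeq V_f(R)^{\times}\simeq R[\theta_1]^{\times}$. (2) Suppose $f$ is reducible over $R$ (so $d\in R^2$). (i) If $f$ has no double root in $R$, let $H_R=\{(x,y)\in R\times R: x\equiv y \pmod{\sqrt d}\}$ (equal to $R\times R$ if $d\in R^{\times}$). Then $\psi_R:V_f(R)\to H_R$, $(a_1,a_0)^T\mapsto(a_1-a_0\theta_1,a_1-a_0\theta_2)$, is an isomorphism of $R$-algebras, giving $\mathscr S(f,R)^{\times}\simeq V_f(R)^{\times}\simeq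 H_R^{\times}=\{(x,y)\in R^{\times}\times R^{\times}: x\equiv y\pmod{\sqrt d}\}$. (ii) If $f$ has a double root $\theta\in R$, then $\psi_R:V_f(R)\to R[\varepsilon]/(\varepsilon^2)$, $(a_1,a_0)^T\mapsto a_1-a_0(\varepsilon+\theta)\bmod \varepsilon^2$, is an isomorphism of $R$-algebras, giving $\mathscr S(f,R)^{\times}\simeq V_f(R)^{\times}\simeq (R[\varepsilon]/(\varepsilon^2))^{\times}=\{x+y\varepsilon: x\in R^{\times}, y\in R\}$.
   Context: Here $\sqrt d$ denotes a square root of $d$ in $R$ (e.g. $\theta_1-\theta_2$). *)

theory Defs
  imports "HOL-Algebra.Algebraic_Closure" "HOL-Algebra.Chinese_Remainder" "HOL-Algebra.Module"
begin

definition algebra_of_hom :: "('a \<Rightarrow> 'b) \<Rightarrow> ('b, 'n) ring_scheme \<Rightarrow> ('a, 'b) module"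
  where "algebra_of_hom h S =
    \<lparr> carrier = carrier S, monoid.mult = monoid.mult S, one = one S, zero = zero S, add = add S,
      smult = (\<lambda>r x. h r \<otimes>\<^bsub>S\<^esub> x) \<rparr>"

definition algebra_iso ::
    "('a, 'm) ring_scheme \<Rightarrow> ('a, 'b, 'n) module_scheme \<Rightarrow> ('a, 'c, 'k) module_scheme
      \<Rightarrow> ('b \<Rightarrow> 'c) set"
  where "algebra_iso R A B =
    {h \<in> ring_iso A B. \<forall>r\<in>carrier R. \<forall>x\<in>carrier A. h (r \<odot>\<^bsub>A\<^esub> x) = r \<odot>\<^bsub>B\<^esub> h x}"

text \<open>Transport of structure along a map \<open>\<phi>\<close>, meant to be a bijection from \<open>C\<close> onto the carrier
  of the given structure.\<close>

definition transport_algebra ::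
    "'b set \<Rightarrow> ('b \<Rightarrow> 'c) \<Rightarrow> ('a, 'c, 'k) module_scheme \<Rightarrow> ('a, 'b) module"
  where "transport_algebra C \<phi> A =
    \<lparr> carrier = C,
      monoid.mult = (\<lambda>x y. inv_into C \<phi> (\<phi> x \<otimes>\<^bsub>A\<^esub> \<phi> y)),
      one = inv_into C \<phi> \<one>\<^bsub>A\<^esub>,
      zero = inv_into C \<phi> \<zero>\<^bsub>A\<^esub>,
      add = (\<lambda>x y. inv_into C \<phi> (\<phi> x \<oplus>\<^bsub>A\<^esub> \<phi> y)),
      smult = (\<lambda>r x. inv_into C \<phi> (r \<odot>\<^bsub>A\<^esub> \<phi> x)) \<rparr>"

definition transport_monoid :: "'b set \<Rightarrow> ('b \<Rightarrow> 'c) \<Rightarrow> ('c, 'k) monoid_scheme \<Rightarrow> 'b monoid"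
  where "transport_monoid C \<phi> G =
    \<lparr> carrier = C,
      monoid.mult = (\<lambda>x y. inv_into C \<phi> (\<phi> x \<otimes>\<^bsub>G\<^esub> \<phi> y)),
      one = inv_into C \<phi> \<one>\<^bsub>G\<^esub> \<rparr>"

definition fractions_in ::
    "('a, 'm) ring_scheme \<Rightarrow> ('b, 'n) ring_scheme \<Rightarrow> ('a \<Rightarrow> 'b) \<Rightarrow> 'b set"
  where "fractions_in R L \<iota> =
    {\<iota> a \<otimes>\<^bsub>L\<^esub> inv\<^bsub>L\<^esub> (\<iota> b) | a b. a \<in> carrier R \<and> b \<in> carrier R \<and> b \<noteq> \<zero>\<^bsub>R\<^esub>}"

text \<open>\<open>L\<close> is an algebraic closure of the fraction field of \<open>R\<close>, where \<open>R\<close> is identified with its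
  image under \<open>\<iota>\<close>.\<close>

definition alg_closure_of_fractions ::
    "('a, 'm) ring_scheme \<Rightarrow> ('b, 'n) ring_scheme \<Rightarrow> ('a \<Rightarrow> 'b) \<Rightarrow> bool"
  where "alg_closure_of_fractions R L \<iota> \<longleftrightarrow>
    \<iota> \<in> ring_hom R L \<and> inj_on \<iota> (carrier R) \<and> algebraic_closure L (fractions_in R L \<iota>)"

definition adjoin ::
    "('a, 'm) ring_scheme \<Rightarrow> ('b, 'n) ring_scheme \<Rightarrow> ('a \<Rightarrow> 'b) \<Rightarrow> 'b \<Rightarrow> ('a, 'b) module"
  where "adjoin R L \<iota> \<theta> =
    algebra_of_hom \<iota> (L\<lparr>carrier := ring.simple_extension L (\<iota> ` carrier R) \<theta>\<rparr>)"

text \<open>Polynomials are coefficient lists, leading coefficient first: this is \<open>t\<^sup>2 - P t + Q\<close>.\<close>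

definition quad_poly :: "('a, 'm) ring_scheme \<Rightarrow> 'a \<Rightarrow> 'a \<Rightarrow> 'a list"
  where "quad_poly R P Q = [\<one>\<^bsub>R\<^esub>, \<ominus>\<^bsub>R\<^esub> P, Q]"

definition discr :: "('a, 'm) ring_scheme \<Rightarrow> 'a \<Rightarrow> 'a \<Rightarrow> 'a"
  where "discr R P Q = P [^]\<^bsub>R\<^esub> (2::nat) \<ominus>\<^bsub>R\<^esub> [(4::nat)] \<cdot>\<^bsub>R\<^esub> Q"

definition double_root :: "('a, 'm) ring_scheme \<Rightarrow> 'a list \<Rightarrow> 'a \<Rightarrow> bool"
  where "double_root R p \<theta> \<longleftrightarrow> \<theta> \<in> carrier R \<and> ring.alg_mult R p \<theta> = 2"

text \<open>\<open>residue_class R p q\<close> is the class of \<open>q\<close> in \<open>R[t]/(p)\<close>.\<close>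

definition residue_class :: "('a, 'm) ring_scheme \<Rightarrow> 'a list \<Rightarrow> 'a list \<Rightarrow> 'a list set"
  where "residue_class R p q = (PIdl\<^bsub>poly_ring R\<^esub> p) +>\<^bsub>poly_ring R\<^esub> q"

definition residue_algebra :: "('a, 'm) ring_scheme \<Rightarrow> 'a list \<Rightarrow> ('a, 'a list set) module"
  where "residue_algebra R p =
    algebra_of_hom (\<lambda>r. residue_class R p (ring.poly_of_const R r)) (Rupt\<^bsub>R\<^esub> (carrier R) p)"

definition order_alg :: "('a, 'm) ring_scheme \<Rightarrow> 'a \<Rightarrow> 'a \<Rightarrow> ('a, 'a list set) module"
  where "order_alg R P Q = residue_algebra R (quad_poly R P Q)"

text \<open>The column vector \<open>(a\<^sub>1, a\<^sub>0)\<close> is the pair \<open>(a1, a0)\<close>; it corresponds to \<open>a\<^sub>1 - a\<^sub>0 t\<close>.\<close>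

definition vec_to_order :: "('a, 'm) ring_scheme \<Rightarrow> 'a \<Rightarrow> 'a \<Rightarrow> 'a \<times> 'a \<Rightarrow> 'a list set"
  where "vec_to_order R P Q = (\<lambda>(a1, a0).
    residue_class R (quad_poly R P Q)
      (ring.poly_of_const R a1 \<ominus>\<^bsub>poly_ring R\<^esub> ring.poly_of_const R a0 \<otimes>\<^bsub>poly_ring R\<^esub> X\<^bsub>R\<^esub>))"

definition vec_alg :: "('a, 'm) ring_scheme \<Rightarrow> 'a \<Rightarrow> 'a \<Rightarrow> ('a, 'a \<times> 'a) module"
  where "vec_alg R P Q =
    transport_algebra (carrier R \<times> carrier R) (vec_to_order R P Q) (order_alg R P Q)"

definition seq_init :: "(int \<Rightarrow> 'a) \<Rightarrow> 'a \<times> 'a"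
  where "seq_init w = (w 1, w 0)"

definition unit_seqs :: "('a, 'm) ring_scheme \<Rightarrow> 'a \<Rightarrow> 'a \<Rightarrow> (int \<Rightarrow> 'a) set"
  where "unit_seqs R P Q =
    {w. (\<forall>n. w n \<in> carrier R) \<and>
        (\<forall>n. w (n + 2) \<ominus>\<^bsub>R\<^esub> P \<otimes>\<^bsub>R\<^esub> w (n + 1) \<oplus>\<^bsub>R\<^esub> Q \<otimes>\<^bsub>R\<^esub> w n = \<zero>\<^bsub>R\<^esub>) \<and>
        seq_init w \<in> Units (vec_alg R P Q)}"

definition unit_seq_group :: "('a, 'm) ring_scheme \<Rightarrow> 'a \<Rightarrow> 'a \<Rightarrow> (int \<Rightarrow> 'a) monoid"
  where "unit_seq_group R P Q =
    transport_monoid (unit_seqs R P Q) seq_init (units_of (vec_alg R P Q))"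

definition congr_mod :: "('a, 'm) ring_scheme \<Rightarrow> 'a \<Rightarrow> 'a \<Rightarrow> 'a \<Rightarrow> bool"
  where "congr_mod R s x y \<longleftrightarrow> x \<ominus>\<^bsub>R\<^esub> y \<in> PIdl\<^bsub>R\<^esub> s"

definition congr_pairs_alg :: "('a, 'm) ring_scheme \<Rightarrow> 'a \<Rightarrow> ('a, 'a \<times> 'a) module"
  where "congr_pairs_alg R s =
    algebra_of_hom (\<lambda>r. (r, r))
      ((RDirProd R R)\<lparr>carrier := {(x, y) \<in> carrier R \<times> carrier R. congr_mod R s x y}\<rparr>)"

definition eps_sq :: "('a, 'm) ring_scheme \<Rightarrow> 'a list"
  where "eps_sq R = X\<^bsub>R\<^esub> [^]\<^bsub>poly_ring R\<^esub> (2::nat)"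

definition dual_numbers :: "('a, 'm) ring_scheme \<Rightarrow> ('a, 'a list set) module"
  where "dual_numbers R = residue_algebra R (eps_sq R)"

end

theory Submission
  imports Defs
begin

text \<open>
  Every map in the theorem has the form \<open>(a\<^sub>1, a\<^sub>0) \<mapsto> k a\<^sub>1 - k a\<^sub>0 \<tau>\<close> for a ring homomorphism \<open>k\<close> out of
  \<open>R\<close> and an element \<open>\<tau>\<close> with \<open>\<tau>\<^sup>2 - k P \<tau> + k Q = 0\<close>, and every such map is a homomorphism of algebras.
  Since \<open>f\<close> is monic, \<open>1\<close> and \<open>t\<close> form a basis of \<open>R[t]/(f)\<close>, so only bijectivity remains in each case.
  For irreducible \<open>f\<close>, a failure of injectivity puts \<open>\<theta>\<^sub>1\<close> into the fraction field, hence into \<open>R\<close> because a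
  factorial domain is integrally closed, and then \<open>f\<close> is reducible. For two distinct roots the image is
  cut out by \<open>x - y = - a\<^sub>0 (\<theta>\<^sub>1 - \<theta>\<^sub>2)\<close>. For a double root, shifting the variable by \<open>\<theta>\<close> turns \<open>f\<close>
  into \<open>\<epsilon>\<^sup>2\<close>, the case \<open>P = Q = 0\<close> of \<open>R[t]/(f)\<close>. The units of \<open>V\<^sub>f(R)\<close> are the elements of invertible norm,
  and a sequence is determined by \<open>(w\<^sub>1, w\<^sub>0)\<close> in both directions because \<open>Q\<close> is a unit.
\<close>

subsection \<open>Algebras and transport of structure\<close>

text \<open>The operations of \<open>vec_alg\<close> are given through a bijection and its inverse,
  which is useless for computing. The way out is that the structure map \<open>(a1, a0)\<close> to
  \<open>a1 - a0 t\<close> has the common form itself, with \<tau> the class of t. Its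
  multiplication law, read from right to left, yields closed formulas for the product on pairs, and
  each of the other maps satisfies the same law in its own target. The roots enter through their sum
  P and product Q. Substituting these for P and Q turns every claim about roots into an identity in
  free variables; since \<open>(P + sqrt d) / 2\<close> is never formed, characteristic 2 needs no
  separate treatment. R is not a field, so division of polynomials and the passage from a factor to
  a root both rest on leading coefficients being units, which f being monic guarantees. The square
  root s of d is arbitrary: in a domain it is the difference of the roots up to sign, so it defines
  the same congruence.\<close>

lemma algebra_of_hom_simps [simp]:
  "carrier (algebra_of_hom h S) = carrier S"
  "monoid.mult (algebra_of_hom h S) = monoid.mult S"
  "one (algebra_of_hom h S) = one S"
  "zero (algebra_of_hom h S) = zero S"
  "add (algebra_of_hom h S) = add S"
  "smult (algebra_of_hom h S) r x = h r \<otimes>\<^bsub>S\<^esub> x"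
  by (simp_all add: algebra_of_hom_def)

lemma cring_algebra_of_hom:
  assumes "cring S"
  shows "cring (algebra_of_hom h S)"
proof -
  interpret cring S by fact
  show ?thesis
  proof (rule cringI)
    show "abelian_group (algebra_of_hom h S)"
      by (rule abelian_groupI) (auto simp: a_ac intro: l_neg)
    show "comm_monoid (algebra_of_hom h S)"
      by (rule comm_monoidI) (auto simp: m_ac)
  qed (auto simp: l_distr)
qed

lemma algebra_algebra_of_hom:
  assumes "cring R" "cring S" "h \<in> ring_hom R S"
  shows "algebra R (algebra_of_hom h S)"
proof -
  interpret S: cring S by fact
  note h = ring_hom_memE[OF assms(3)]
  show ?thesis
    using assms(1)
    by (rule algebraI[OF _ cring_algebra_of_hom[OF assms(2)]])
       (auto simp: h S.l_distr S.r_distr S.m_assoc)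
qed

lemma ring_hom_Units_in:
  assumes "monoid A" "h \<in> ring_hom A B" "x \<in> Units A"
  shows "h x \<in> Units B"
proof -
  interpret A: monoid A by fact
  note h = ring_hom_memE[OF assms(2)]
  obtain y where y: "y \<in> carrier A" "y \<otimes>\<^bsub>A\<^esub> x = \<one>\<^bsub>A\<^esub>" "x \<otimes>\<^bsub>A\<^esub> y = \<one>\<^bsub>A\<^esub>" and x: "x \<in> carrier A"
    using assms(3) unfolding Units_def by auto
  have "h y \<otimes>\<^bsub>B\<^esub> h x = \<one>\<^bsub>B\<^esub>" "h x \<otimes>\<^bsub>B\<^esub> h y = \<one>\<^bsub>B\<^esub>"
    using x y h(2)[OF x y(1)] h(2)[OF y(1) x] h(4) by auto
  then show ?thesis
    using x y h(1) unfolding Units_def by auto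
qed

text \<open>Homomorphisms preserve units, and this applies to the inverse map as well. It later
  carries an explicit description of units across an isomorphism.\<close>

lemma ring_iso_image_Units:
  assumes "ring A" "ring B" "h \<in> ring_iso A B"
  shows "h ` Units A = Units B"
proof -
  interpret A: ring A by fact
  interpret B: ring B by fact
  have h: "h \<in> ring_hom A B" and bij: "bij_betw h (carrier A) (carrier B)"
    using assms(3) by (auto simp: ring_iso_def)
  have inv: "inv_into (carrier A) h \<in> ring_hom B A"
    using ring_iso_set_sym[OF assms(1,3)] by (simp add: ring_iso_def)
  show ?thesis
  proof
    show "h ` Units A \<subseteq> Units B"
      using ring_hom_Units_in[OF A.monoid_axioms h] by auto
    show "Units B \<subseteq> h ` Units A"
    proof
      fix y assume y: "y \<in> Units B"
      then have "h (inv_into (carrier A) h y) = y"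
        using bij by (metis B.Units_closed bij_betw_inv_into_right)
      then show "y \<in> h ` Units A"
        using ring_hom_Units_in[OF B.monoid_axioms inv y] by (metis image_eqI)
    qed
  qed
qed

lemma ring_iso_units_iso:
  assumes "ring A" "ring B" "h \<in> ring_iso A B"
  shows "h \<in> iso (units_of A) (units_of B)"
proof -
  interpret A: ring A by fact
  have "bij_betw h (Units A) (Units B)"
    using assms(3) ring_iso_image_Units[OF assms] unfolding ring_iso_def bij_betw_def
    by (auto intro: inj_on_subset)
  moreover have "h (x \<otimes>\<^bsub>A\<^esub> y) = h x \<otimes>\<^bsub>B\<^esub> h y" if "x \<in> Units A" "y \<in> Units A" for x y
    using assms(3) that[THEN A.Units_closed] by (auto simp: ring_iso_def ring_hom_def)
  ultimately show ?thesis
    by (auto simp: iso_def hom_def units_of_carrier units_of_mult bij_betw_def)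
qed

lemma transport_algebra:
  assumes "algebra R A" and bij: "bij_betw \<phi> C (carrier A)"
  shows "algebra R (transport_algebra C \<phi> A)"
    and "\<phi> \<in> algebra_iso R (transport_algebra C \<phi> A) A"
proof -
  interpret A: algebra R A by fact
  let ?T = "transport_algebra C \<phi> A"
  let ?g = "inv_into C \<phi>"
  have g: "?g x \<in> C" "\<phi> (?g x) = x" if "x \<in> carrier A" for x
    using that bij by (auto simp: bij_betw_inv_into_right bij_betwE[OF bij_betw_inv_into])
  have g': "?g (\<phi> x) = x" "\<phi> x \<in> carrier A" if "x \<in> C" for x
    using that bij by (auto simp: bij_betw_inv_into_left bij_betwE)
  have carr: "carrier ?T = C"
    and mult: "\<And>x y. x \<otimes>\<^bsub>?T\<^esub> y = ?g (\<phi> x \<otimes>\<^bsub>A\<^esub> \<phi> y)"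
    and add: "\<And>x y. x \<oplus>\<^bsub>?T\<^esub> y = ?g (\<phi> x \<oplus>\<^bsub>A\<^esub> \<phi> y)"
    and smult: "\<And>r x. r \<odot>\<^bsub>?T\<^esub> x = ?g (r \<odot>\<^bsub>A\<^esub> \<phi> x)"
    and one: "\<one>\<^bsub>?T\<^esub> = ?g \<one>\<^bsub>A\<^esub>" and zero: "\<zero>\<^bsub>?T\<^esub> = ?g \<zero>\<^bsub>A\<^esub>"
    by (simp_all add: transport_algebra_def)
  have "?g \<in> ring_iso A ?T"
    using bij_betw_inv_into[OF bij]
    by (intro ring_iso_memI) (auto simp: carr mult add one g)
  \<comment> \<open>The image ring comes with its zero replaced by the image of zero. The
    transported structure has exactly that zero, so the update changes nothing.\<close>
  then have "cring (?T\<lparr>zero := ?g \<zero>\<^bsub>A\<^esub>\<rparr>)"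
    by (rule cring.ring_iso_imp_img_cring[OF A.M_cring])
  then have T: "cring ?T"
    by (simp add: transport_algebra_def)
  show "algebra R ?T"
    using A.R.cring_axioms T
    by (rule algebraI)
       (auto simp: carr mult add smult g g' A.smult_l_distr A.smult_r_distr A.smult_assoc1
         A.smult_assoc2)
  have "\<phi> \<in> ring_iso ?T A"
    using bij by (intro ring_iso_memI) (auto simp: carr mult add one g g')
  then show "\<phi> \<in> algebra_iso R ?T A"
    by (auto simp: algebra_iso_def carr smult g g')
qed

subsection \<open>Residue classes modulo a monic quadratic polynomial\<close>

text \<open>Polynomials are lists with nonzero leading coefficient; \<open>normalize\<close> covers
  the cases where b, or both a and b, vanish.\<close>

lemma (in domain) const_minus_const_mult_X:
  assumes "a \<in> carrier R" "b \<in> carrier R"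
  shows "poly_of_const a \<ominus>\<^bsub>poly_ring R\<^esub> poly_of_const b \<otimes>\<^bsub>poly_ring R\<^esub> X = normalize [\<ominus> b, a]"
proof -
  have b: "poly_of_const b \<in> carrier (poly_ring R)"
    using assms(2) by (auto simp: poly_of_const_def univ_poly_def polynomial_def)
  have bX: "poly_of_const b \<otimes>\<^bsub>poly_ring R\<^esub> X = (if b = \<zero> then [] else [b, \<zero>])"
    using poly_mult_var[OF carrier_is_subring b] by (simp add: poly_of_const_def)
  have "(if b = \<zero> then [] else [b, \<zero>]) \<in> carrier (poly_ring R)"
    using assms by (auto simp: univ_poly_def polynomial_def)
  from univ_poly_a_inv_def'[OF carrier_is_subring this]
  have "\<ominus>\<^bsub>poly_ring R\<^esub> (poly_of_const b \<otimes>\<^bsub>poly_ring R\<^esub> X) = (if b = \<zero> then [] else [\<ominus> b, \<zero>])"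
    unfolding bX by simp
  then show ?thesis
    using assms by (auto simp: a_minus_def[of "poly_ring R"] poly_of_const_def univ_poly_add)
qed

lemma (in domain) quad_poly_closed:
  assumes "P \<in> carrier R" "Q \<in> carrier R"
  shows "quad_poly R P Q \<in> carrier (poly_ring R)"
  using assms by (auto simp: quad_poly_def univ_poly_def polynomial_def)

lemma (in domain) residue_class_eq_zero_iff:
  assumes "p \<in> carrier (poly_ring R)" "q \<in> carrier (poly_ring R)"
  shows "residue_class R p q = \<zero>\<^bsub>Rupt (carrier R) p\<^esub> \<longleftrightarrow> p pdivides q"
proof -
  interpret UP: domain "poly_ring R"
    using univ_poly_is_domain[OF carrier_is_subring] .
  have I: "ideal (PIdl\<^bsub>poly_ring R\<^esub> p) (poly_ring R)"
    by (rule UP.cgenideal_ideal) fact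
  have "residue_class R p q = \<zero>\<^bsub>Rupt (carrier R) p\<^esub> \<longleftrightarrow> q \<in> PIdl\<^bsub>poly_ring R\<^esub> p"
    unfolding residue_class_def rupture_def FactRing_def
    using UP.quotient_eq_iff_same_a_r_cos[OF I assms(2) UP.zero_closed] assms(2)
      UP.a_rcos_zero[OF I additive_subgroup.zero_closed[OF ideal.axioms(1)[OF I]]]
    by (simp add: a_minus_def[of "poly_ring R"])
  also have "\<dots> \<longleftrightarrow> p pdivides q"
    using assms UP.m_comm unfolding pdivides_def factor_def cgenideal_def by auto
  finally show ?thesis .
qed

lemma (in domain) normalize_pair_inj:
  assumes "normalize [a, b] = normalize [c, d]"
  shows "a = c \<and> b = d"
  using assms by (auto split: if_splits)

text \<open>Injective because a polynomial of degree at most 1 that is divisible by a monic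
  quadratic is zero; surjective because every class contains its remainder modulo that
  quadratic.\<close>

lemma (in domain) vec_to_order_bij_betw:
  assumes "P \<in> carrier R" "Q \<in> carrier R"
  shows "bij_betw (vec_to_order R P Q) (carrier R \<times> carrier R) (carrier (order_alg R P Q))"
proof -
  let ?p = "quad_poly R P Q"
  let ?S = "Rupt (carrier R) ?p"
  let ?h = "residue_class R ?p"
  interpret UP: domain "poly_ring R"
    using univ_poly_is_domain[OF carrier_is_subring] .
  have p: "?p \<in> carrier (poly_ring R)" "polynomial (carrier R) ?p"
    using quad_poly_closed[OF assms] by (simp_all add: univ_poly_carrier)
  interpret h: ring_hom_ring "poly_ring R" ?S ?h
    using rupture_surj_hom(2)[OF carrier_is_subring p(1)] by (simp add: residue_class_def[abs_def])
  have v: "vec_to_order R P Q (a, b) = ?h (normalize [\<ominus> b, a])" if "a \<in> carrier R" "b \<in> carrier R" for a b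
    using that by (simp add: vec_to_order_def const_minus_const_mult_X)
  have n: "normalize [\<ominus> b, a] \<in> carrier (poly_ring R)" if "a \<in> carrier R" "b \<in> carrier R" for a b
    using normalize_gives_polynomial[of "[\<ominus> b, a]" "carrier R"] that by (simp add: univ_poly_carrier)
  have "inj_on (vec_to_order R P Q) (carrier R \<times> carrier R)"
  proof (rule inj_onI, clarify)
    fix a b c d
    assume car: "a \<in> carrier R" "b \<in> carrier R" "c \<in> carrier R" "d \<in> carrier R"
      and eq: "vec_to_order R P Q (a, b) = vec_to_order R P Q (c, d)"
    let ?u = "normalize [\<ominus> b, a]" and ?w = "normalize [\<ominus> d, c]"
    let ?q = "?u \<ominus>\<^bsub>poly_ring R\<^esub> ?w"
    have q: "?q \<in> carrier (poly_ring R)"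
      using car n by blast
    have "?h ?q = \<zero>\<^bsub>?S\<^esub>"
      using eq car n by (simp add: v a_minus_def[of "poly_ring R"] h.S.r_neg del: normalize.simps)
    then have div: "?p pdivides ?q"
      using residue_class_eq_zero_iff[OF p(1) q] by blast
    \<comment> \<open>Both lists have length at most 2; negation keeps the length and a sum is no
      longer than its longer summand. The divisor has degree 2, which leaves only the zero
      polynomial.\<close>
    have "degree ?q \<le> 1"
    proof -
      have "length ?u \<le> 2" "length ?w \<le> 2"
        using normalize_length_le[of "[\<ominus> b, a]"] normalize_length_le[of "[\<ominus> d, c]"] by simp_all
      moreover have "length (\<ominus>\<^bsub>poly_ring R\<^esub> ?w) = length ?w"
        using univ_poly_a_inv_length[OF carrier_is_subring n] car by blast
      ultimately show ?thesis
        using poly_add_length_le[of ?u "\<ominus>\<^bsub>poly_ring R\<^esub> ?w"]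
        by (simp add: a_minus_def[of "poly_ring R"] univ_poly_add del: poly_add.simps normalize.simps)
    qed
    then have "?q = \<zero>\<^bsub>poly_ring R\<^esub>"
      using pdivides_imp_degree_le[OF carrier_is_subring p(1) q _ div]
      by (auto simp: quad_poly_def univ_poly_zero simp del: normalize.simps)
    then have "?u = ?w"
      using car n UP.r_right_minus_eq by blast
    then show "a = c \<and> b = d"
      using normalize_pair_inj car by (metis minus_minus)
  qed
  moreover have "vec_to_order R P Q ` (carrier R \<times> carrier R) = carrier ?S"
  proof
    show "vec_to_order R P Q ` (carrier R \<times> carrier R) \<subseteq> carrier ?S"
      using v n h.hom_closed by auto
    show "carrier ?S \<subseteq> vec_to_order R P Q ` (carrier R \<times> carrier R)"
    proof
      fix s assume "s \<in> carrier ?S"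
      then obtain f where f: "f \<in> carrier (poly_ring R)" "s = ?h f"
        unfolding rupture_def FactRing_def A_RCOSETS_def' residue_class_def by auto
      \<comment> \<open>Division with remainder is available over R because the leading coefficient
        of f is 1, a unit.\<close>
      then obtain g r where g: "g \<in> carrier (poly_ring R)" and r: "r \<in> carrier (poly_ring R)"
        and eq: "f = ?p \<otimes>\<^bsub>poly_ring R\<^esub> g \<oplus>\<^bsub>poly_ring R\<^esub> r" and deg: "r = [] \<or> degree r < degree ?p"
        using long_division_theorem[OF carrier_is_subring, of f ?p] p(2)
        by (auto simp: univ_poly_carrier quad_poly_def)
      have "?h ?p = \<zero>\<^bsub>?S\<^esub>"
        using residue_class_eq_zero_iff[OF p(1) p(1)] UP.divides_refl p(1) by (simp add: pdivides_def)
      then have s: "s = ?h r"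
        using f(2) eq g r p(1) h.S.l_null h.S.l_zero by simp
      have "\<exists>a b. a \<in> carrier R \<and> b \<in> carrier R \<and> r = normalize [\<ominus> b, a]"
      proof -
        have "length r \<le> 2"
          using deg by (auto simp: quad_poly_def)
        then consider "r = []" | a where "r = [a]" | b a where "r = [b, a]"
          by (cases r; cases "tl r"; cases "tl (tl r)") auto
        then show ?thesis
        proof cases
          case 1
          then show ?thesis by (intro exI[of _ \<zero>]) simp
        next
          case (2 a)
          then show ?thesis
            using r by (intro exI[of _ a] exI[of _ \<zero>]) (auto simp: univ_poly_def polynomial_def)
        next
          \<comment> \<open>The second coordinate is minus the leading coefficient, because pairs
            encode \<open>a1 - a0 t\<close>.\<close>
          case (3 b a)
          then show ?thesis
            using r by (intro exI[of _ a] exI[of _ "\<ominus> b"]) (auto simp: univ_poly_def polynomial_def)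
        qed
      qed
      then obtain a b where ab: "a \<in> carrier R" "b \<in> carrier R" "r = normalize [\<ominus> b, a]"
        by blast
      then have "s = vec_to_order R P Q (a, b)"
        using s v by presburger
      then show "s \<in> vec_to_order R P Q ` (carrier R \<times> carrier R)"
        using ab(1,2) by blast
    qed
  qed
  ultimately show ?thesis
    by (simp add: bij_betw_def order_alg_def residue_algebra_def)
qed

lemma (in domain) ring_hom_const_residue:
  assumes "p \<in> carrier (poly_ring R)"
  shows "(\<lambda>r. residue_class R p (poly_of_const r)) \<in> ring_hom R (Rupt (carrier R) p)"
  using rupture_surj_norm_is_hom[OF carrier_is_subring assms]
  by (simp add: residue_class_def comp_def)

lemma (in domain) cring_rupture:
  assumes "p \<in> carrier (poly_ring R)"
  shows "cring (Rupt (carrier R) p)"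
  unfolding rupture_def
  by (intro ideal.quotient_is_cring cring.cgenideal_ideal univ_poly_is_cring carrier_is_subring assms)

lemma (in domain) algebra_residue_algebra:
  assumes "p \<in> carrier (poly_ring R)"
  shows "algebra R (residue_algebra R p)"
  unfolding residue_algebra_def
  by (intro algebra_algebra_of_hom cring_rupture ring_hom_const_residue assms) unfold_locales

lemma (in domain) algebra_order_alg:
  assumes "P \<in> carrier R" "Q \<in> carrier R"
  shows "algebra R (order_alg R P Q)"
  unfolding order_alg_def by (rule algebra_residue_algebra[OF quad_poly_closed[OF assms]])

lemma (in domain)
  assumes "P \<in> carrier R" "Q \<in> carrier R"
  shows algebra_vec_alg: "algebra R (vec_alg R P Q)"
    and vec_to_order_iso: "vec_to_order R P Q \<in> algebra_iso R (vec_alg R P Q) (order_alg R P Q)"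
  unfolding vec_alg_def
  by (rule transport_algebra[OF algebra_order_alg[OF assms] vec_to_order_bij_betw[OF assms]])+

lemma carrier_vec_alg [simp]: "carrier (vec_alg R P Q) = carrier R \<times> carrier R"
  by (simp add: vec_alg_def transport_algebra_def)

subsection \<open>Algebra maps defined by a root\<close>

text \<open>This is the product formula of \<open>linear_mult_eq\<close> after all of its relations
  have been substituted: \<open>u + b t\<close> stands for a, \<open>v + d t\<close> for c and
  \<open>p t - t t\<close> for q. What remains holds for arbitrary elements.\<close>

lemma (in cring) linear_mult_identity:
  assumes "u \<in> carrier R" "v \<in> carrier R" "b \<in> carrier R" "d \<in> carrier R" "t \<in> carrier R" "p \<in> carrier R"
  shows "(u \<oplus> b \<otimes> t) \<otimes> (v \<oplus> d \<otimes> t) \<ominus> (p \<otimes> t \<ominus> t \<otimes> t) \<otimes> (b \<otimes> d)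
    = u \<otimes> v \<oplus> ((u \<oplus> b \<otimes> t) \<otimes> d \<oplus> b \<otimes> (v \<oplus> d \<otimes> t) \<ominus> p \<otimes> (b \<otimes> d)) \<otimes> t"
  using assms by algebra

text \<open>Expanding \<open>(a - b t)(c - d t)\<close> and replacing \<open>t t\<close> by
  \<open>p t - q\<close> gives \<open>(a c - q b d) - (a d + b c - p b d) t\<close>. Here u, v, w
  are the three values, each described by adding the t-term back.\<close>

lemma (in cring) linear_mult_eq:
  assumes "a \<in> carrier R" "b \<in> carrier R" "c \<in> carrier R" "d \<in> carrier R"
      "p \<in> carrier R" "q \<in> carrier R" "t \<in> carrier R" "u \<in> carrier R" "v \<in> carrier R" "w \<in> carrier R"
    and t: "t \<otimes> t \<oplus> q = p \<otimes> t"
    and u: "u \<oplus> b \<otimes> t = a" and v: "v \<oplus> d \<otimes> t = c"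
    and w: "w \<oplus> (a \<otimes> d \<oplus> b \<otimes> c \<ominus> p \<otimes> (b \<otimes> d)) \<otimes> t = a \<otimes> c \<ominus> q \<otimes> (b \<otimes> d)"
  shows "w = u \<otimes> v"
proof -
  have "q = p \<otimes> t \<ominus> t \<otimes> t"
    unfolding t[symmetric] using assms(5-7) by algebra
  then have "a \<otimes> c \<ominus> q \<otimes> (b \<otimes> d) = u \<otimes> v \<oplus> (a \<otimes> d \<oplus> b \<otimes> c \<ominus> p \<otimes> (b \<otimes> d)) \<otimes> t"
    using linear_mult_identity[of u v b d t p] assms(1-10) unfolding u v by simp
  then show ?thesis
    using w assms(1-10) by simp
qed

text \<open>The equations for \<open>\<tau>\<close> and \<open>\<psi>\<close> avoid subtraction, because \<open>\<ominus>\<close> of a structure with restricted carrier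
  is not syntactically the one of the ambient ring.\<close>

locale quad_root = R: domain R + S: cring S
  for R :: "('a, 'm) ring_scheme" and S :: "('b, 'n) ring_scheme" +
  fixes k :: "'a \<Rightarrow> 'b" and P Q :: 'a and \<tau> :: 'b and \<psi> :: "'a \<times> 'a \<Rightarrow> 'b"
  assumes k: "k \<in> ring_hom R S"
    and PQ: "P \<in> carrier R" "Q \<in> carrier R"
    and \<tau>: "\<tau> \<in> carrier S" "\<tau> \<otimes>\<^bsub>S\<^esub> \<tau> \<oplus>\<^bsub>S\<^esub> k Q = k P \<otimes>\<^bsub>S\<^esub> \<tau>"
    and \<psi>: "\<And>a b. a \<in> carrier R \<Longrightarrow> b \<in> carrier R \<Longrightarrow> \<psi> (a, b) \<in> carrier S"
      "\<And>a b. a \<in> carrier R \<Longrightarrow> b \<in> carrier R \<Longrightarrow> \<psi> (a, b) \<oplus>\<^bsub>S\<^esub> k b \<otimes>\<^bsub>S\<^esub> \<tau> = k a"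
begin

sublocale k: ring_hom_cring R S k
  by (unfold_locales) (rule k)

lemma k_minus: "a \<in> carrier R \<Longrightarrow> b \<in> carrier R \<Longrightarrow> k (a \<ominus>\<^bsub>R\<^esub> b) = k a \<ominus>\<^bsub>S\<^esub> k b"
  by (simp add: a_minus_def)

text \<open>By cancellation the defining equation determines \<psi>, so each algebraic law below
  reduces to checking that equation for the candidate value.\<close>

lemma \<psi>_eqI:
  assumes "a \<in> carrier R" "b \<in> carrier R" "x \<in> carrier S" "x \<oplus>\<^bsub>S\<^esub> k b \<otimes>\<^bsub>S\<^esub> \<tau> = k a"
  shows "\<psi> (a, b) = x"
proof -
  have "\<psi> (a, b) \<oplus>\<^bsub>S\<^esub> k b \<otimes>\<^bsub>S\<^esub> \<tau> = x \<oplus>\<^bsub>S\<^esub> k b \<otimes>\<^bsub>S\<^esub> \<tau>"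
    by (simp only: \<psi>(2)[OF assms(1,2)] assms(4))
  then show ?thesis
    using \<psi>(1)[OF assms(1,2)] assms(2,3) \<tau>(1) by simp
qed

lemma \<psi>_add:
  assumes "a \<in> carrier R" "b \<in> carrier R" "c \<in> carrier R" "d \<in> carrier R"
  shows "\<psi> (a \<oplus>\<^bsub>R\<^esub> c, b \<oplus>\<^bsub>R\<^esub> d) = \<psi> (a, b) \<oplus>\<^bsub>S\<^esub> \<psi> (c, d)"
proof (rule \<psi>_eqI)
  have "\<psi> (a, b) \<oplus>\<^bsub>S\<^esub> \<psi> (c, d) \<oplus>\<^bsub>S\<^esub> (k b \<oplus>\<^bsub>S\<^esub> k d) \<otimes>\<^bsub>S\<^esub> \<tau>
      = (\<psi> (a, b) \<oplus>\<^bsub>S\<^esub> k b \<otimes>\<^bsub>S\<^esub> \<tau>) \<oplus>\<^bsub>S\<^esub> (\<psi> (c, d) \<oplus>\<^bsub>S\<^esub> k d \<otimes>\<^bsub>S\<^esub> \<tau>)"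
    using assms \<tau>(1) by (simp add: \<psi>(1) S.l_distr S.a_ac)
  then show "\<psi> (a, b) \<oplus>\<^bsub>S\<^esub> \<psi> (c, d) \<oplus>\<^bsub>S\<^esub> k (b \<oplus>\<^bsub>R\<^esub> d) \<otimes>\<^bsub>S\<^esub> \<tau> = k (a \<oplus>\<^bsub>R\<^esub> c)"
    using assms by (simp add: \<psi>)
qed (use assms \<psi>(1) in simp_all)

text \<open>The pair on the left does not involve S or \<tau>: it is the same for all instances, and
  \<open>vec_alg_ops\<close> recognizes it as the product in \<open>vec_alg\<close>.\<close>

lemma \<psi>_mult:
  assumes "a \<in> carrier R" "b \<in> carrier R" "c \<in> carrier R" "d \<in> carrier R"
  shows "\<psi> (a \<otimes>\<^bsub>R\<^esub> c \<ominus>\<^bsub>R\<^esub> Q \<otimes>\<^bsub>R\<^esub> (b \<otimes>\<^bsub>R\<^esub> d),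
      a \<otimes>\<^bsub>R\<^esub> d \<oplus>\<^bsub>R\<^esub> b \<otimes>\<^bsub>R\<^esub> c \<ominus>\<^bsub>R\<^esub> P \<otimes>\<^bsub>R\<^esub> (b \<otimes>\<^bsub>R\<^esub> d)) = \<psi> (a, b) \<otimes>\<^bsub>S\<^esub> \<psi> (c, d)"
proof -
  let ?x = "a \<otimes>\<^bsub>R\<^esub> c \<ominus>\<^bsub>R\<^esub> Q \<otimes>\<^bsub>R\<^esub> (b \<otimes>\<^bsub>R\<^esub> d)"
  let ?y = "a \<otimes>\<^bsub>R\<^esub> d \<oplus>\<^bsub>R\<^esub> b \<otimes>\<^bsub>R\<^esub> c \<ominus>\<^bsub>R\<^esub> P \<otimes>\<^bsub>R\<^esub> (b \<otimes>\<^bsub>R\<^esub> d)"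
  have xy: "?x \<in> carrier R" "?y \<in> carrier R"
    using assms PQ by simp_all
  have kx: "k ?x = k a \<otimes>\<^bsub>S\<^esub> k c \<ominus>\<^bsub>S\<^esub> k Q \<otimes>\<^bsub>S\<^esub> (k b \<otimes>\<^bsub>S\<^esub> k d)"
    and ky: "k ?y = k a \<otimes>\<^bsub>S\<^esub> k d \<oplus>\<^bsub>S\<^esub> k b \<otimes>\<^bsub>S\<^esub> k c \<ominus>\<^bsub>S\<^esub> k P \<otimes>\<^bsub>S\<^esub> (k b \<otimes>\<^bsub>S\<^esub> k d)"
    using assms PQ by (simp_all add: k_minus)
  show ?thesis
    by (rule S.linear_mult_eq[OF _ _ _ _ _ _ \<tau>(1) _ _ _ \<tau>(2) \<psi>(2)[OF assms(1,2)] \<psi>(2)[OF assms(3,4)]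
          \<psi>(2)[OF xy, unfolded kx ky]])
       (rule k.hom_closed \<psi>(1) assms PQ xy)+
qed

lemma \<psi>_one: "\<psi> (\<one>\<^bsub>R\<^esub>, \<zero>\<^bsub>R\<^esub>) = \<one>\<^bsub>S\<^esub>"
  using \<tau>(1) by (intro \<psi>_eqI) simp_all

lemma \<psi>_smult:
  assumes "r \<in> carrier R" "a \<in> carrier R" "b \<in> carrier R"
  shows "\<psi> (r \<otimes>\<^bsub>R\<^esub> a, r \<otimes>\<^bsub>R\<^esub> b) = k r \<otimes>\<^bsub>S\<^esub> \<psi> (a, b)"
proof (rule \<psi>_eqI)
  have "k r \<otimes>\<^bsub>S\<^esub> \<psi> (a, b) \<oplus>\<^bsub>S\<^esub> k (r \<otimes>\<^bsub>R\<^esub> b) \<otimes>\<^bsub>S\<^esub> \<tau> = k r \<otimes>\<^bsub>S\<^esub> (\<psi> (a, b) \<oplus>\<^bsub>S\<^esub> k b \<otimes>\<^bsub>S\<^esub> \<tau>)"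
    using assms \<tau>(1) by (simp add: \<psi>(1) S.r_distr S.m_assoc)
  then show "k r \<otimes>\<^bsub>S\<^esub> \<psi> (a, b) \<oplus>\<^bsub>S\<^esub> k (r \<otimes>\<^bsub>R\<^esub> b) \<otimes>\<^bsub>S\<^esub> \<tau> = k (r \<otimes>\<^bsub>R\<^esub> a)"
    using assms by (simp add: \<psi>)
qed (use assms \<psi>(1) in simp_all)

end

context domain
begin

context
  fixes P Q
  assumes PQ: "P \<in> carrier R" "Q \<in> carrier R"
begin

text \<open>The structure map is the universal instance, with \<tau> the class of t. It is the
  source of the formulas for \<open>vec_alg\<close>.\<close>

lemma quad_root_vec_to_order:
  "quad_root R (Rupt (carrier R) (quad_poly R P Q))
    (\<lambda>r. residue_class R (quad_poly R P Q) (poly_of_const r)) P Q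
    (residue_class R (quad_poly R P Q) X) (vec_to_order R P Q)"
proof -
  let ?p = "quad_poly R P Q"
  let ?S = "Rupt (carrier R) ?p"
  let ?h = "residue_class R ?p"
  let ?k = "\<lambda>r. ?h (poly_of_const r)"
  have p: "?p \<in> carrier (poly_ring R)"
    using quad_poly_closed[OF PQ] .
  interpret UP: domain "poly_ring R"
    using univ_poly_is_domain[OF carrier_is_subring] .
  interpret S: cring ?S
    by (rule cring_rupture[OF p])
  interpret h: ring_hom_ring "poly_ring R" ?S ?h
    using rupture_surj_hom(2)[OF carrier_is_subring p] by (simp add: residue_class_def[abs_def])
  have c: "poly_of_const a \<in> carrier (poly_ring R)" if "a \<in> carrier R" for a
    using that by (auto simp: poly_of_const_def univ_poly_def polynomial_def)
  have X: "X \<in> carrier (poly_ring R)"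
    using var_closed carrier_is_subring by blast
  have vec: "vec_to_order R P Q (a, b) = ?k a \<ominus>\<^bsub>?S\<^esub> ?k b \<otimes>\<^bsub>?S\<^esub> ?h X" if "a \<in> carrier R" "b \<in> carrier R" for a b
    using that c X by (simp add: vec_to_order_def a_minus_def)
  \<comment> \<open>The identity \<open>t^2 + Q = f + P t\<close> in R[t], arranged without
    subtraction. In the quotient f vanishes and the equation required of \<tau> is left.\<close>
  have "X \<otimes>\<^bsub>poly_ring R\<^esub> X \<oplus>\<^bsub>poly_ring R\<^esub> poly_of_const Q
      = ?p \<oplus>\<^bsub>poly_ring R\<^esub> poly_of_const P \<otimes>\<^bsub>poly_ring R\<^esub> X"
    using PQ poly_mult_var[OF carrier_is_subring X] poly_mult_var[OF carrier_is_subring c[OF PQ(1)]]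
    by (auto simp: quad_poly_def var_def poly_of_const_def univ_poly_add l_neg r_neg)
  from arg_cong[where f = ?h, OF this]
  have "?h X \<otimes>\<^bsub>?S\<^esub> ?h X \<oplus>\<^bsub>?S\<^esub> ?k Q = ?h ?p \<oplus>\<^bsub>?S\<^esub> ?k P \<otimes>\<^bsub>?S\<^esub> ?h X"
    using c[OF PQ(1)] c[OF PQ(2)] X p by simp
  moreover have "?h ?p = \<zero>\<^bsub>?S\<^esub>"
    using residue_class_eq_zero_iff[OF p p] UP.divides_refl p by (simp add: pdivides_def)
  ultimately have root: "?h X \<otimes>\<^bsub>?S\<^esub> ?h X \<oplus>\<^bsub>?S\<^esub> ?k Q = ?k P \<otimes>\<^bsub>?S\<^esub> ?h X"
    using c[OF PQ(1)] X by simp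
  show ?thesis
  proof
    show "vec_to_order R P Q (a, b) \<oplus>\<^bsub>?S\<^esub> ?k b \<otimes>\<^bsub>?S\<^esub> ?h X = ?k a" if "a \<in> carrier R" "b \<in> carrier R" for a b
      using that c X by (simp add: vec a_minus_def S.a_assoc S.l_neg)
    show "vec_to_order R P Q (a, b) \<in> carrier ?S" if "a \<in> carrier R" "b \<in> carrier R" for a b
      using that c X by (simp add: vec)
    show "?k \<in> ring_hom R ?S"
      by (rule ring_hom_const_residue[OF p])
    show "?h X \<otimes>\<^bsub>?S\<^esub> ?h X \<oplus>\<^bsub>?S\<^esub> ?k Q = ?k P \<otimes>\<^bsub>?S\<^esub> ?h X"
      by (rule root)
    show "?h X \<in> carrier ?S"
      using X by simp
  qed (rule PQ)+
qed

text \<open>The laws of the structure map, used from right to left, write each result in R[t]/(f) as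
  the image of an explicit pair, on which the inverse of the bijection cancels.\<close>

lemma vec_alg_ops:
  shows vec_alg_mult: "\<lbrakk>a \<in> carrier R; b \<in> carrier R; c \<in> carrier R; d \<in> carrier R\<rbrakk> \<Longrightarrow>
      (a, b) \<otimes>\<^bsub>vec_alg R P Q\<^esub> (c, d)
        = (a \<otimes> c \<ominus> Q \<otimes> (b \<otimes> d), a \<otimes> d \<oplus> b \<otimes> c \<ominus> P \<otimes> (b \<otimes> d))"
    and vec_alg_add: "\<lbrakk>a \<in> carrier R; b \<in> carrier R; c \<in> carrier R; d \<in> carrier R\<rbrakk> \<Longrightarrow>
      (a, b) \<oplus>\<^bsub>vec_alg R P Q\<^esub> (c, d) = (a \<oplus> c, b \<oplus> d)"
    and vec_alg_smult: "\<lbrakk>r \<in> carrier R; a \<in> carrier R; b \<in> carrier R\<rbrakk> \<Longrightarrow>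
      r \<odot>\<^bsub>vec_alg R P Q\<^esub> (a, b) = (r \<otimes> a, r \<otimes> b)"
    and vec_alg_one: "\<one>\<^bsub>vec_alg R P Q\<^esub> = (\<one>, \<zero>)"
proof -
  interpret h: quad_root R "Rupt (carrier R) (quad_poly R P Q)"
    "\<lambda>r. residue_class R (quad_poly R P Q) (poly_of_const r)" P Q
    "residue_class R (quad_poly R P Q) X" "vec_to_order R P Q"
    by (rule quad_root_vec_to_order)
  have inj: "inj_on (vec_to_order R P Q) (carrier R \<times> carrier R)"
    using vec_to_order_bij_betw[OF PQ] by (rule bij_betw_imp_inj_on)
  have inv: "inv_into (carrier R \<times> carrier R) (vec_to_order R P Q) (vec_to_order R P Q x) = x"
    if "x \<in> carrier R \<times> carrier R" for x
    using inv_into_f_f[OF inj that] .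
  note defs = vec_alg_def transport_algebra_def order_alg_def residue_algebra_def
  show "(a, b) \<otimes>\<^bsub>vec_alg R P Q\<^esub> (c, d)
        = (a \<otimes> c \<ominus> Q \<otimes> (b \<otimes> d), a \<otimes> d \<oplus> b \<otimes> c \<ominus> P \<otimes> (b \<otimes> d))"
    if "a \<in> carrier R" "b \<in> carrier R" "c \<in> carrier R" "d \<in> carrier R"
    using that PQ by (simp add: defs inv flip: h.\<psi>_mult)
  show "(a, b) \<oplus>\<^bsub>vec_alg R P Q\<^esub> (c, d) = (a \<oplus> c, b \<oplus> d)"
    if "a \<in> carrier R" "b \<in> carrier R" "c \<in> carrier R" "d \<in> carrier R"
    using that PQ by (simp add: defs inv flip: h.\<psi>_add)
  show "r \<odot>\<^bsub>vec_alg R P Q\<^esub> (a, b) = (r \<otimes> a, r \<otimes> b)"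
    if "r \<in> carrier R" "a \<in> carrier R" "b \<in> carrier R"
    using that PQ by (simp add: defs inv flip: h.\<psi>_smult)
  show "\<one>\<^bsub>vec_alg R P Q\<^esub> = (\<one>, \<zero>)"
    by (simp add: defs inv flip: h.\<psi>_one)
qed

end

end

context quad_root
begin

lemma \<psi>_algebra_iso:
  assumes "bij_betw \<psi> (carrier R \<times> carrier R) (carrier S)"
  shows "\<psi> \<in> algebra_iso R (vec_alg R P Q) (algebra_of_hom k S)"
proof -
  have "\<psi> \<in> ring_iso (vec_alg R P Q) (algebra_of_hom k S)"
    using assms
    by (intro ring_iso_memI)
       (auto simp: \<psi>(1) R.vec_alg_ops[OF PQ] \<psi>_mult \<psi>_add \<psi>_one)
  then show ?thesis
    by (auto simp: algebra_iso_def R.vec_alg_ops[OF PQ] \<psi>_smult)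
qed

end

lemma algebra_iso_units_iso:
  assumes "algebra R A" "algebra R B" "h \<in> algebra_iso R A B"
  shows "h \<in> iso (units_of A) (units_of B)"
proof (rule ring_iso_units_iso)
  show "ring A" "ring B"
    by (rule cring.axioms(1)[OF algebra.M_cring[OF assms(1)]],
        rule cring.axioms(1)[OF algebra.M_cring[OF assms(2)]])
  show "h \<in> ring_iso A B"
    using assms(3) by (simp add: algebra_iso_def)
qed

lemma (in quad_root) \<psi>_iso:
  assumes "bij_betw \<psi> (carrier R \<times> carrier R) (carrier S)"
  shows "algebra R (algebra_of_hom k S)"
    and "\<psi> \<in> algebra_iso R (vec_alg R P Q) (algebra_of_hom k S)"
    and "\<psi> \<in> iso (units_of (vec_alg R P Q)) (units_of (algebra_of_hom k S))"
proof -
  show alg: "algebra R (algebra_of_hom k S)"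
    by (rule algebra_algebra_of_hom[OF R.cring_axioms S.cring_axioms k])
  show iso: "\<psi> \<in> algebra_iso R (vec_alg R P Q) (algebra_of_hom k S)"
    by (rule \<psi>_algebra_iso[OF assms])
  show "\<psi> \<in> iso (units_of (vec_alg R P Q)) (units_of (algebra_of_hom k S))"
    by (rule algebra_iso_units_iso[OF R.algebra_vec_alg[OF PQ] alg iso])
qed

subsection \<open>Units and the norm\<close>

lemma (in cring) nat_pow_2: "x \<in> carrier R \<Longrightarrow> x [^] (2::nat) = x \<otimes> x"
  by (simp add: numeral_2_eq_2)

text \<open>Cramer's rule. Multiplication by \<open>(a, b)\<close> has matrix rows
  \<open>(a, - q b)\<close> and \<open>(b, a - p b)\<close>; the norm is its determinant, and the
  right-hand sides apply the adjugate matrix to the product with \<open>(c, d)\<close>.\<close>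

lemma (in cring) quad_norm_mult_inverse:
  assumes "a \<in> carrier R" "b \<in> carrier R" "c \<in> carrier R" "d \<in> carrier R" "p \<in> carrier R" "q \<in> carrier R"
  shows "(a \<otimes> a \<ominus> p \<otimes> b \<otimes> a \<oplus> q \<otimes> (b \<otimes> b)) \<otimes> c
      = (a \<ominus> p \<otimes> b) \<otimes> (a \<otimes> c \<ominus> q \<otimes> (b \<otimes> d)) \<oplus> q \<otimes> b \<otimes> (a \<otimes> d \<oplus> b \<otimes> c \<ominus> p \<otimes> (b \<otimes> d))"
    "(a \<otimes> a \<ominus> p \<otimes> b \<otimes> a \<oplus> q \<otimes> (b \<otimes> b)) \<otimes> d
      = a \<otimes> (a \<otimes> d \<oplus> b \<otimes> c \<ominus> p \<otimes> (b \<otimes> d)) \<ominus> b \<otimes> (a \<otimes> c \<ominus> q \<otimes> (b \<otimes> d))"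
  using assms by algebra+

text \<open>\<open>(a - p b, - b)\<close> is the conjugate of \<open>(a, b)\<close>: exchanging the
  roots turns \<open>a - b t\<close> into \<open>a - b (p - t)\<close>. The norm is invariant under
  this.\<close>

lemma (in cring) quad_norm_conj:
  assumes "a \<in> carrier R" "b \<in> carrier R" "p \<in> carrier R" "q \<in> carrier R"
  shows "(a \<ominus> p \<otimes> b) \<otimes> (a \<ominus> p \<otimes> b) \<ominus> p \<otimes> \<ominus> b \<otimes> (a \<ominus> p \<otimes> b) \<oplus> q \<otimes> (\<ominus> b \<otimes> \<ominus> b)
    = a \<otimes> a \<ominus> p \<otimes> b \<otimes> a \<oplus> q \<otimes> (b \<otimes> b)"
  using assms by algebra

lemma (in cring) quad_norm_scale:
  assumes "a \<in> carrier R" "b \<in> carrier R" "p \<in> carrier R" "q \<in> carrier R" "n \<in> carrier R"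
  shows "(n \<otimes> a) \<otimes> (n \<otimes> a) \<ominus> p \<otimes> (n \<otimes> b) \<otimes> (n \<otimes> a) \<oplus> q \<otimes> ((n \<otimes> b) \<otimes> (n \<otimes> b))
    = n \<otimes> (n \<otimes> (a \<otimes> a \<ominus> p \<otimes> b \<otimes> a \<oplus> q \<otimes> (b \<otimes> b)))"
  using assms by algebra

text \<open>An element times its conjugate is its norm. The scalar e is carried along so that the
  inverse of the norm can be put in its place.\<close>

lemma (in cring) quad_conj_identity:
  assumes "a \<in> carrier R" "b \<in> carrier R" "p \<in> carrier R" "q \<in> carrier R" "e \<in> carrier R"
  shows "a \<otimes> ((a \<ominus> p \<otimes> b) \<otimes> e) \<ominus> q \<otimes> (b \<otimes> (\<ominus> b \<otimes> e))
      = (a \<otimes> a \<ominus> p \<otimes> b \<otimes> a \<oplus> q \<otimes> (b \<otimes> b)) \<otimes> e"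
    "a \<otimes> (\<ominus> b \<otimes> e) \<oplus> b \<otimes> ((a \<ominus> p \<otimes> b) \<otimes> e) \<ominus> p \<otimes> (b \<otimes> (\<ominus> b \<otimes> e)) = \<zero>"
  using assms by algebra+

lemma (in cring) Units_divide:
  assumes "x \<otimes> y \<in> Units R" "x \<in> carrier R" "y \<in> carrier R"
  shows "x \<in> Units R"
proof -
  have "x divides x \<otimes> y"
    using assms(3) by (rule dividesI) simp
  then have "x divides \<one>"
    using assms divides_one[of "x \<otimes> y"] divides_trans[of x "x \<otimes> y" \<one>] by simp
  then show ?thesis
    using assms(2) divides_one by blast
qed

text \<open>An invertible norm gives the inverse as conjugate over norm. Conversely, Cramer's rule
  identifies the norm times the inverse with the conjugate, and comparing norms of these two shows
  that the norm is invertible.\<close>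

lemma (in domain) Units_vec_alg:
  assumes "P \<in> carrier R" "Q \<in> carrier R"
  shows "Units (vec_alg R P Q) = {(a1, a0) \<in> carrier R \<times> carrier R.
    a1 [^] (2::nat) \<ominus> P \<otimes> a0 \<otimes> a1 \<oplus> Q \<otimes> a0 [^] (2::nat) \<in> Units R}" (is "_ = ?U")
proof -
  interpret V: algebra R "vec_alg R P Q"
    by (rule algebra_vec_alg[OF assms])
  define N where "N = (\<lambda>a b. a \<otimes> a \<ominus> P \<otimes> b \<otimes> a \<oplus> Q \<otimes> (b \<otimes> b))"
  have N: "N a b \<in> carrier R" if "a \<in> carrier R" "b \<in> carrier R" for a b
    using that assms by (simp add: N_def)
  note ops = vec_alg_mult[OF assms] vec_alg_one[OF assms]
  have "(a, b) \<in> Units (vec_alg R P Q) \<longleftrightarrow> N a b \<in> Units R" if ab: "a \<in> carrier R" "b \<in> carrier R" for a b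
  proof
    assume "(a, b) \<in> Units (vec_alg R P Q)"
    then obtain c d where cd: "c \<in> carrier R" "d \<in> carrier R"
      and "(a, b) \<otimes>\<^bsub>vec_alg R P Q\<^esub> (c, d) = \<one>\<^bsub>vec_alg R P Q\<^esub>"
      unfolding Units_def by auto
    then have eq: "a \<otimes> c \<ominus> Q \<otimes> (b \<otimes> d) = \<one>" "a \<otimes> d \<oplus> b \<otimes> c \<ominus> P \<otimes> (b \<otimes> d) = \<zero>"
      using ab by (simp_all add: ops)
    let ?n = "N a b"
    have nc: "?n \<otimes> c = a \<ominus> P \<otimes> b" and nd: "?n \<otimes> d = \<ominus> b"
      using quad_norm_mult_inverse[OF ab cd assms] ab cd assms
      unfolding eq N_def by (simp_all add: a_minus_def)
    \<comment> \<open>With n = 0 the two formulas force b = 0 and then a = 0, contradicting that the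
      product is 1.\<close>
    have "?n \<noteq> \<zero>"
    proof
      assume n0: "?n = \<zero>"
      have "b = \<zero>"
        using nd ab cd unfolding n0 by (metis l_null minus_minus minus_zero)
      moreover from this have "a = \<zero>"
        using nc ab cd assms unfolding n0 by (simp add: a_minus_def)
      ultimately have "b = \<zero>" "a = \<zero>"
        by simp_all
      then show False
        using eq(1) cd assms by (simp add: a_minus_def)
    qed
    \<comment> \<open>Norms of both sides of \<open>n (c, d) = (a - P b, - b)\<close>: the norm is
      homogeneous of degree 2, so the left side gives \<open>n n N(c, d)\<close> and the right side
      n. One factor n then cancels.\<close>
    have "?n \<otimes> (?n \<otimes> N c d) = N (?n \<otimes> c) (?n \<otimes> d)"
      using quad_norm_scale[OF cd assms N[OF ab]] unfolding N_def by (rule sym)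
    also have "\<dots> = N (a \<ominus> P \<otimes> b) (\<ominus> b)"
      by (simp only: nc nd)
    also have "\<dots> = ?n"
      using quad_norm_conj[OF ab assms] unfolding N_def .
    also have "\<dots> = ?n \<otimes> \<one>"
      using N[OF ab] by simp
    finally have "?n \<otimes> (?n \<otimes> N c d) = ?n \<otimes> \<one>" .
    then have "?n \<otimes> N c d = \<one>"
      using m_lcancel[of ?n "?n \<otimes> N c d" \<one>] \<open>?n \<noteq> \<zero>\<close> N[OF ab] N[OF cd] by simp
    then show "N a b \<in> Units R"
      using Units_divide[of "N a b" "N c d"] N[OF ab] N[OF cd] by simp
  next
    assume u: "N a b \<in> Units R"
    let ?e = "inv (N a b)"
    let ?c = "(a \<ominus> P \<otimes> b) \<otimes> ?e" and ?d = "\<ominus> b \<otimes> ?e"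
    have e: "?e \<in> carrier R" "N a b \<otimes> ?e = \<one>"
      using u by simp_all
    have cd: "?c \<in> carrier R" "?d \<in> carrier R"
      using e(1) ab assms by simp_all
    have "a \<otimes> ?c \<ominus> Q \<otimes> (b \<otimes> ?d) \<ominus> N a b \<otimes> ?e = \<zero>"
      using quad_conj_identity(1)[OF ab assms e(1)] N[OF ab] e(1) by (simp add: N_def)
    then have 1: "a \<otimes> ?c \<ominus> Q \<otimes> (b \<otimes> ?d) = \<one>"
      unfolding e(2) using ab cd assms by simp
    have 2: "a \<otimes> ?d \<oplus> b \<otimes> ?c \<ominus> P \<otimes> (b \<otimes> ?d) = \<zero>"
      by (rule quad_conj_identity(2)[OF ab assms e(1)])
    have "(a, b) \<otimes>\<^bsub>vec_alg R P Q\<^esub> (?c, ?d) = \<one>\<^bsub>vec_alg R P Q\<^esub>"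
      unfolding ops(1)[OF ab cd] ops(2) 1 2 ..
    moreover from this have "(?c, ?d) \<otimes>\<^bsub>vec_alg R P Q\<^esub> (a, b) = \<one>\<^bsub>vec_alg R P Q\<^esub>"
      using V.m_comm ab cd by simp
    ultimately show "(a, b) \<in> Units (vec_alg R P Q)"
      unfolding Units_def using ab cd by auto
  qed
  moreover have "Units (vec_alg R P Q) \<subseteq> carrier R \<times> carrier R"
    by (auto simp: Units_def)
  ultimately have "Units (vec_alg R P Q) = {(a, b) \<in> carrier R \<times> carrier R. N a b \<in> Units R}"
    by blast
  then show ?thesis
    by (auto simp: N_def nat_pow_2)
qed

subsection \<open>Two-sided recurrent sequences\<close>

text \<open>The state after n steps is \<open>(w (n+1), w n)\<close>, so the seed
  \<open>(x, y)\<close> has the order of \<open>seq_init\<close> and the second component is the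
  n-th term.\<close>

primrec lucas_iter :: "('a, 'm) ring_scheme \<Rightarrow> 'a \<Rightarrow> 'a \<Rightarrow> 'a \<Rightarrow> 'a \<Rightarrow> nat \<Rightarrow> 'a \<times> 'a" where
  "lucas_iter R P Q x y 0 = (x, y)"
| "lucas_iter R P Q x y (Suc n) =
    (case lucas_iter R P Q x y n of (u, v) \<Rightarrow> (P \<otimes>\<^bsub>R\<^esub> u \<ominus>\<^bsub>R\<^esub> Q \<otimes>\<^bsub>R\<^esub> v, u))"

lemma (in cring) lucas_iter_closed:
  assumes "P \<in> carrier R" "Q \<in> carrier R" "x \<in> carrier R" "y \<in> carrier R"
  shows "fst (lucas_iter R P Q x y n) \<in> carrier R \<and> snd (lucas_iter R P Q x y n) \<in> carrier R"
  using assms by (induction n) (auto split: prod.splits)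

lemma snd_lucas_iter:
  "snd (lucas_iter R P Q x y (Suc (Suc n)))
    = P \<otimes>\<^bsub>R\<^esub> snd (lucas_iter R P Q x y (Suc n)) \<ominus>\<^bsub>R\<^esub> Q \<otimes>\<^bsub>R\<^esub> snd (lucas_iter R P Q x y n)"
  by (simp split: prod.splits)

text \<open>Backwards, a sequence satisfies the recurrence with parameters \<open>P/Q\<close> and \<open>1/Q\<close>.\<close>

lemma (in cring) recurrence_extension:
  assumes "P \<in> carrier R" "Q \<in> Units R" "x \<in> carrier R" "y \<in> carrier R"
  obtains w :: "int \<Rightarrow> 'a" where "w 1 = x" "w 0 = y" "\<And>n. w n \<in> carrier R"
    "\<And>n. w (n + 2) \<ominus> P \<otimes> w (n + 1) \<oplus> Q \<otimes> w n = \<zero>"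
proof -
  let ?f = "\<lambda>n. snd (lucas_iter R P Q x y n)"
  \<comment> \<open>The reversed sequence with m-th term \<open>w (1 - m)\<close> starts with x, y;
    hence the seed with its entries exchanged.\<close>
  let ?g = "\<lambda>n. snd (lucas_iter R (P \<otimes> inv Q) (inv Q) y x n)"
  define w where "w n = (if n \<ge> 0 then ?f (nat n) else ?g (nat (1 - n)))" for n :: int
  have Q: "Q \<in> carrier R" "inv Q \<in> carrier R" "Q \<otimes> inv Q = \<one>"
    using assms(2) by (simp_all add: Units_closed)
  have f: "?f n \<in> carrier R" and g: "?g n \<in> carrier R" for n
    using lucas_iter_closed assms Q by simp_all
  have w1: "w 1 = x" and w0: "w 0 = y"
    by (simp_all add: w_def)
  \<comment> \<open>The two branches agree at 0 and 1. For negative n the indices n, n+1, n+2 are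
    all at most 1, so that instance of the recurrence lies entirely in the backward branch.\<close>
  have w': "w n = ?g (nat (1 - n))" if n: "n \<le> 1" for n
  proof -
    consider "n < 0" | "n = 0" | "n = 1"
      using n by linarith
    then show ?thesis
      by cases (simp_all add: w_def)
  qed
  have rec: "w (n + 2) \<ominus> P \<otimes> w (n + 1) \<oplus> Q \<otimes> w n = \<zero>" for n
  proof (cases "n \<ge> 0")
    case True
    then obtain m where m: "n = int m"
      using zero_le_imp_eq_int by blast
    have "w (int i) = ?f i" for i
      by (simp add: w_def)
    from this[of m] this[of "Suc m"] this[of "Suc (Suc m)"]
    have "w n = ?f m" "w (n + 1) = ?f (Suc m)" "w (n + 2) = ?f (Suc (Suc m))"
      by (simp_all add: m add.commute del: lucas_iter.simps)
    moreover have "(P \<otimes> b \<ominus> Q \<otimes> a) \<ominus> P \<otimes> b \<oplus> Q \<otimes> a = \<zero>" if "a \<in> carrier R" "b \<in> carrier R" for a b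
      using that assms(1) Q(1) by algebra
    ultimately show ?thesis
      unfolding snd_lucas_iter using f by (simp del: lucas_iter.simps)
  next
    case False
    \<comment> \<open>The backward indices of n+2, n+1, n are m, m+1, m+2; thus \<open>w n\<close>
      is computed as \<open>(P w (n+1) - w (n+2)) / Q\<close>.\<close>
    define m where "m = nat (- 1 - n)"
    have "nat (1 - n) = Suc (Suc m)" "nat (1 - (n + 1)) = Suc m" "nat (1 - (n + 2)) = m"
      using False by (simp_all add: m_def)
    then have "w n = ?g (Suc (Suc m))" "w (n + 1) = ?g (Suc m)" "w (n + 2) = ?g m"
      using w'[of n] w'[of "n + 1"] w'[of "n + 2"] False by (simp_all del: lucas_iter.simps)
    moreover have "a \<ominus> P \<otimes> b \<oplus> Q \<otimes> (P \<otimes> inv Q \<otimes> b \<ominus> inv Q \<otimes> a) = \<zero>"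
      if "a \<in> carrier R" "b \<in> carrier R" for a b
    proof -
      have "Q \<otimes> (P \<otimes> inv Q \<otimes> b \<ominus> inv Q \<otimes> a) = P \<otimes> (Q \<otimes> inv Q) \<otimes> b \<ominus> (Q \<otimes> inv Q) \<otimes> a"
        using that assms(1) Q(1,2) by algebra
      then show ?thesis
        unfolding Q(3) using that assms(1) by algebra
    qed
    ultimately show ?thesis
      unfolding snd_lucas_iter using g by (simp del: lucas_iter.simps)
  qed
  show thesis
    by (rule that[OF w1 w0 _ rec]) (simp add: w_def f g)
qed

text \<open>Each recurrence equation can be solved for its last term, and for its first one since Q
  is invertible. Agreement of two consecutive terms therefore spreads in both directions.\<close>

lemma (in cring) recurrence_unique:
  fixes w w' :: "int \<Rightarrow> 'a"
  assumes "P \<in> carrier R" "Q \<in> Units R"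
    and w: "\<And>n. w n \<in> carrier R" "\<And>n. w (n + 2) \<ominus> P \<otimes> w (n + 1) \<oplus> Q \<otimes> w n = \<zero>"
    and w': "\<And>n. w' n \<in> carrier R" "\<And>n. w' (n + 2) \<ominus> P \<otimes> w' (n + 1) \<oplus> Q \<otimes> w' n = \<zero>"
    and eq: "w 0 = w' 0" "w 1 = w' 1"
  shows "w = w'"
proof -
  have Q: "Q \<in> carrier R" "inv Q \<in> carrier R" "inv Q \<otimes> Q = \<one>"
    using assms(2) by (simp_all add: Units_closed)
  have up: "c = P \<otimes> b \<ominus> Q \<otimes> a" and down: "a = inv Q \<otimes> (P \<otimes> b \<ominus> c)"
    if abc: "a \<in> carrier R" "b \<in> carrier R" "c \<in> carrier R" "c \<ominus> P \<otimes> b \<oplus> Q \<otimes> a = \<zero>" for a b c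
  proof -
    have "c = (c \<ominus> P \<otimes> b \<oplus> Q \<otimes> a) \<oplus> (P \<otimes> b \<ominus> Q \<otimes> a)"
      using abc(1-3) assms(1) Q(1) by algebra
    then show c: "c = P \<otimes> b \<ominus> Q \<otimes> a"
      unfolding abc(4) using abc(1,2) assms(1) Q(1) by simp
    have "inv Q \<otimes> (P \<otimes> b \<ominus> (P \<otimes> b \<ominus> Q \<otimes> a)) = (inv Q \<otimes> Q) \<otimes> a"
      using abc(1,2) assms(1) Q(1,2) by algebra
    then show "a = inv Q \<otimes> (P \<otimes> b \<ominus> c)"
      unfolding Q(3) c[symmetric] using abc(1) by simp
  qed
  have "w n = w' n \<and> w (n + 1) = w' (n + 1)" for n :: int
  proof (induction n rule: int_induct[where k = 0])
    case base
    show ?case using eq by simp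
  next
    case (step1 n)
    have "w (n + 2) = w' (n + 2)"
      using up[OF w(1) w(1) w(1) w(2)[of n]] up[OF w'(1) w'(1) w'(1) w'(2)[of n]] step1 by simp
    then show ?case
      using step1 by (simp add: add.assoc)
  next
    case (step2 n)
    have "w (n - 1) = w' (n - 1)"
      using down[OF w(1) w(1) w(1) w(2)[of "n - 1"]] down[OF w'(1) w'(1) w'(1) w'(2)[of "n - 1"]] step2
      by (simp add: algebra_simps)
    then show ?case
      using step2 by simp
  qed
  then show ?thesis
    by blast
qed

text \<open>The unit condition in \<open>unit_seqs\<close> concerns the initial pair alone, so the
  bijection between solutions and initial pairs restricts to units.\<close>

lemma (in domain) seq_init_bij_betw:
  assumes "P \<in> carrier R" "Q \<in> Units R"
  shows "bij_betw seq_init (unit_seqs R P Q) (Units (vec_alg R P Q))"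
proof -
  have "inj_on seq_init (unit_seqs R P Q)"
    using recurrence_unique[OF assms] by (auto simp: inj_on_def unit_seqs_def seq_init_def)
  moreover have "z \<in> seq_init ` unit_seqs R P Q" if z: "z \<in> Units (vec_alg R P Q)" for z
  proof -
    obtain x y where xy: "z = (x, y)" "x \<in> carrier R" "y \<in> carrier R"
      using z by (auto simp: Units_def)
    obtain w :: "int \<Rightarrow> 'a" where "w 1 = x" "w 0 = y" "\<And>n. w n \<in> carrier R"
      "\<And>n. w (n + 2) \<ominus> P \<otimes> w (n + 1) \<oplus> Q \<otimes> w n = \<zero>"
      using recurrence_extension[OF assms xy(2,3)] by blast
    then have "w \<in> unit_seqs R P Q" "seq_init w = z"
      using z xy by (simp_all add: unit_seqs_def seq_init_def)
    then show ?thesis by blast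
  qed
  ultimately show ?thesis
    by (auto simp: bij_betw_def unit_seqs_def)
qed

lemma transport_monoid:
  assumes "group G" and bij: "bij_betw \<phi> C (carrier G)"
  shows "group (transport_monoid C \<phi> G)" "\<phi> \<in> iso (transport_monoid C \<phi> G) G"
proof -
  interpret G: group G by fact
  let ?T = "transport_monoid C \<phi> G"
  let ?g = "inv_into C \<phi>"
  have g: "?g x \<in> C" "\<phi> (?g x) = x" if "x \<in> carrier G" for x
    using that bij by (auto simp: bij_betw_inv_into_right bij_betwE[OF bij_betw_inv_into])
  have g': "?g (\<phi> x) = x" "\<phi> x \<in> carrier G" if "x \<in> C" for x
    using that bij by (auto simp: bij_betw_inv_into_left bij_betwE)
  show "group ?T"
  proof (rule groupI)
    fix x assume x: "x \<in> carrier ?T"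
    then have "?g (inv\<^bsub>G\<^esub> \<phi> x) \<otimes>\<^bsub>?T\<^esub> x = \<one>\<^bsub>?T\<^esub>"
      by (simp add: transport_monoid_def g g')
    then show "\<exists>y\<in>carrier ?T. y \<otimes>\<^bsub>?T\<^esub> x = \<one>\<^bsub>?T\<^esub>"
      using x by (intro bexI[of _ "?g (inv\<^bsub>G\<^esub> \<phi> x)"]) (simp_all add: transport_monoid_def g g')
  qed (simp_all add: transport_monoid_def g g' G.m_assoc)
  show "\<phi> \<in> iso ?T G"
    using bij by (simp add: iso_def hom_def transport_monoid_def g g')
qed

lemma (in domain) unit_seq_group:
  assumes "P \<in> carrier R" "Q \<in> Units R"
  shows "group (unit_seq_group R P Q)"
    and "seq_init \<in> iso (unit_seq_group R P Q) (units_of (vec_alg R P Q))"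
proof -
  interpret V: algebra R "vec_alg R P Q"
    by (rule algebra_vec_alg[OF assms(1) Units_closed[OF assms(2)]])
  have "bij_betw seq_init (unit_seqs R P Q) (carrier (units_of (vec_alg R P Q)))"
    using seq_init_bij_betw[OF assms] by (simp add: units_of_carrier)
  from transport_monoid[OF V.units_group this]
  show "group (unit_seq_group R P Q)"
    and "seq_init \<in> iso (unit_seq_group R P Q) (units_of (vec_alg R P Q))"
    by (simp_all add: unit_seq_group_def)
qed

subsection \<open>Roots and factorizations of quadratic polynomials\<close>

lemma (in domain) linear_mult_linear:
  assumes "a \<in> carrier R" "b \<in> carrier R"
  shows "[\<one>, \<ominus> a] \<otimes>\<^bsub>poly_ring R\<^esub> [\<one>, \<ominus> b] = quad_poly R (a \<oplus> b) (a \<otimes> b)"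
proof -
  have "\<ominus> a \<otimes> \<ominus> b = a \<otimes> b" "\<ominus> b \<oplus> \<ominus> a = \<ominus> (a \<oplus> b)"
    using assms by algebra+
  then show ?thesis
    using assms by (simp add: univ_poly_mult quad_poly_def)
qed

lemma (in domain) monic_linear_closed:
  assumes "a \<in> carrier R"
  shows "[\<one>, \<ominus> a] \<in> carrier (poly_ring R)"
  using assms by (auto simp: univ_poly_def polynomial_def)

lemma (in domain) quad_poly_inj:
  assumes "quad_poly R P Q = quad_poly R P' Q'" "P \<in> carrier R" "P' \<in> carrier R"
  shows "P = P'" "Q = Q'"
proof -
  have "\<ominus> P = \<ominus> P'" "Q = Q'"
    using assms(1) by (simp_all add: quad_poly_def)
  then show "P = P'" "Q = Q'"
    using minus_minus assms(2,3) by metis+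
qed

lemma (in domain) eval_quad_poly:
  assumes "P \<in> carrier R" "Q \<in> carrier R" "x \<in> carrier R"
  shows "eval (quad_poly R P Q) x = x \<otimes> x \<ominus> P \<otimes> x \<oplus> Q"
proof -
  have "eval (quad_poly R P Q) x = x \<otimes> x \<oplus> (\<ominus> P \<otimes> x \<oplus> Q)"
    using assms by (simp add: quad_poly_def numeral_2_eq_2)
  also have "\<dots> = x \<otimes> x \<ominus> P \<otimes> x \<oplus> Q"
    using assms by algebra
  finally show ?thesis .
qed

lemma (in domain) quad_poly_factor_root:
  assumes "P \<in> carrier R" "Q \<in> carrier R" "x \<in> carrier R" "x \<otimes> x \<ominus> P \<otimes> x \<oplus> Q = \<zero>"
  shows "quad_poly R P Q = [\<one>, \<ominus> x] \<otimes>\<^bsub>poly_ring R\<^esub> [\<one>, \<ominus> (P \<ominus> x)]"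
proof -
  have "Q = (x \<otimes> x \<ominus> P \<otimes> x \<oplus> Q) \<oplus> x \<otimes> (P \<ominus> x)"
    using assms(1-3) by algebra
  then have "Q = x \<otimes> (P \<ominus> x)"
    unfolding assms(4) using assms(1-3) by simp
  moreover have "P = x \<oplus> (P \<ominus> x)"
    using assms(1,3) by algebra
  ultimately show ?thesis
    using linear_mult_linear[of x "P \<ominus> x"] assms(1,3) by simp
qed

text \<open>Vieta's relations. Splitting off the root x leaves the factor with root
  \<open>P - x\<close>; comparing multisets, not sets, identifies it with y even if the two roots
  coincide.\<close>

lemma (in field) roots_quad_poly:
  assumes "P \<in> carrier R" "Q \<in> carrier R" "roots (quad_poly R P Q) = {#x, y#}"
  shows "x \<in> carrier R" "y \<in> carrier R" "x \<oplus> y = P" "x \<otimes> y = Q"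
proof -
  have p: "quad_poly R P Q \<in> carrier (poly_ring R)"
    using quad_poly_closed assms by blast
  have "is_root (quad_poly R P Q) x"
    using roots_mem_iff_is_root[OF p, of x] assms(3) by simp
  then have x: "x \<in> carrier R" and "x \<otimes> x \<ominus> P \<otimes> x \<oplus> Q = \<zero>"
    using eval_quad_poly assms(1,2) by (auto simp: is_root_def)
  then have fac: "quad_poly R P Q = [\<one>, \<ominus> x] \<otimes>\<^bsub>poly_ring R\<^esub> [\<one>, \<ominus> (P \<ominus> x)]"
    using quad_poly_factor_root assms(1,2) by blast
  then have "roots (quad_poly R P Q) = {#x, P \<ominus> x#}"
    using x assms(1) by (simp add: poly_mult_degree_one_monic_imp_same_roots monic_degree_one_roots
        monic_linear_closed)
  then have y: "y = P \<ominus> x"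
    using assms(3) by (simp add: add_mset_eq_single)
  show "x \<in> carrier R" "y \<in> carrier R"
    using x y assms(1) by simp_all
  have "quad_poly R P Q = quad_poly R (x \<oplus> y) (x \<otimes> y)"
    using fac linear_mult_linear[of x y] x y assms(1) by simp
  then show "x \<oplus> y = P" "x \<otimes> y = Q"
    using quad_poly_inj[of P Q "x \<oplus> y" "x \<otimes> y"] \<open>x \<in> carrier R\<close> \<open>y \<in> carrier R\<close> assms(1) by auto
qed

lemma (in domain) poly_ring_mult_degree_lead_coeff:
  assumes "p \<in> carrier (poly_ring R)" "q \<in> carrier (poly_ring R)" "p \<noteq> []" "q \<noteq> []"
  shows "degree (p \<otimes>\<^bsub>poly_ring R\<^esub> q) = degree p + degree q"
    and "lead_coeff (p \<otimes>\<^bsub>poly_ring R\<^esub> q) = lead_coeff p \<otimes> lead_coeff q"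
  using poly_mult_degree_eq[OF carrier_is_subring, of p q]
    poly_mult_lead_coeff[OF carrier_is_subring, of p q] assms
  by (simp_all add: univ_poly_carrier univ_poly_mult)

lemma (in domain) const_Units:
  assumes "k \<in> Units R"
  shows "[k] \<in> Units (poly_ring R)"
proof -
  have c: "k \<in> carrier R" "inv k \<in> carrier R" "k \<otimes> inv k = \<one>"  "inv k \<otimes> k = \<one>"
    using assms by (simp_all add: Units_closed)
  then have nz: "k \<noteq> \<zero>" "inv k \<noteq> \<zero>"
    using one_not_zero by auto
  have "[k] \<otimes>\<^bsub>poly_ring R\<^esub> [inv k] = \<one>\<^bsub>poly_ring R\<^esub>" "[inv k] \<otimes>\<^bsub>poly_ring R\<^esub> [k] = \<one>\<^bsub>poly_ring R\<^esub>"
    using c by (simp_all add: univ_poly_mult univ_poly_one)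
  moreover have "[k] \<in> carrier (poly_ring R)" "[inv k] \<in> carrier (poly_ring R)"
    using c nz by (auto simp: univ_poly_def polynomial_def)
  ultimately show ?thesis
    unfolding Units_def by auto
qed

text \<open>The leading coefficients of two factors of a monic polynomial multiply to 1 and are
  units. A nonunit factor is then not constant, so a proper factorization consists of two linear
  factors, and a linear polynomial with unit leading coefficient has a root in R.\<close>

lemma (in domain) reducible_quad_poly:
  assumes "P \<in> carrier R" "Q \<in> carrier R" "\<not> pirreducible (carrier R) (quad_poly R P Q)"
  obtains x where "x \<in> carrier R" "x \<otimes> x \<ominus> P \<otimes> x \<oplus> Q = \<zero>"
proof -
  let ?p = "quad_poly R P Q"
  have p: "?p \<in> carrier (poly_ring R)"
    using quad_poly_closed assms by blast
  have "?p \<notin> Units (poly_ring R)"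
    using univ_poly_carrier_units_incl by (auto simp: quad_poly_def)
  then obtain f g where fg: "f \<in> carrier (poly_ring R)" "g \<in> carrier (poly_ring R)"
    and eq: "?p = f \<otimes>\<^bsub>poly_ring R\<^esub> g" and nu: "f \<notin> Units (poly_ring R)" "g \<notin> Units (poly_ring R)"
    using pirreducibleI[OF carrier_is_subring p] assms(3) by (auto simp: quad_poly_def)
  have ne: "f \<noteq> []" "g \<noteq> []"
    using eq fg poly_mult_zero[of f] poly_mult_zero[of g]
    by (auto simp: univ_poly_mult quad_poly_def polynomial_in_carrier[OF carrier_is_subring] univ_poly_carrier)
  have deg: "degree f + degree g = 2" and lead: "lead_coeff f \<otimes> lead_coeff g = \<one>"
    using poly_ring_mult_degree_lead_coeff[OF fg ne] unfolding eq[symmetric] by (simp_all add: quad_poly_def)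
  have hd: "lead_coeff f \<in> carrier R" "lead_coeff g \<in> carrier R"
    using fg ne by (auto simp: univ_poly_def polynomial_def)
  have u: "lead_coeff f \<in> Units R" "lead_coeff g \<in> Units R"
    using Units_divide[of "lead_coeff f" "lead_coeff g"] Units_divide[of "lead_coeff g" "lead_coeff f"]
      lead hd m_comm by simp_all
  \<comment> \<open>A constant polynomial with unit leading coefficient is a unit of R[t], so a
    nonunit factor has positive degree.\<close>
  have nz: "degree h \<noteq> 0" if "h \<noteq> []" "h \<notin> Units (poly_ring R)" "lead_coeff h \<in> Units R" for h
    using that const_Units by (cases h) auto
  have "degree f = 1"
    using nz[OF ne(1) nu(1) u(1)] nz[OF ne(2) nu(2) u(2)] deg by linarith
  then have "length f = Suc (Suc 0)"
    using ne by (cases f) auto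
  then obtain a b where f: "f = [a, b]"
    by (metis length_0_conv length_Suc_conv)
  have ab: "a \<in> carrier R" "b \<in> carrier R" "inv a \<in> carrier R" "a \<otimes> inv a = \<one>"
    using fg(1) u(1) by (auto simp: f univ_poly_def polynomial_def)
  \<comment> \<open>The root \<open>- b / a\<close> of the linear factor \<open>a t + b\<close>,
    where a is a unit.\<close>
  let ?x = "\<ominus> (inv a \<otimes> b)"
  have x: "?x \<in> carrier R"
    using ab by simp
  have "eval f ?x = \<ominus> ((a \<otimes> inv a) \<otimes> b) \<oplus> b"
    using ab by (simp add: f r_minus flip: m_assoc)
  then have "eval f ?x = \<zero>"
    using ab by (simp add: l_neg)
  then have "eval ?p ?x = \<zero>"
    using pdivides_imp_root_sharing[OF fg(1) _ x, of ?p] eq fg(2) dividesI[of g "poly_ring R" ?p f]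
    by (simp add: pdivides_def)
  then show thesis
    using that x eval_quad_poly assms(1,2) by auto
qed

lemma (in domain) root_imp_not_pirreducible:
  assumes "P \<in> carrier R" "Q \<in> carrier R" "x \<in> carrier R" "x \<otimes> x \<ominus> P \<otimes> x \<oplus> Q = \<zero>"
  shows "\<not> pirreducible (carrier R) (quad_poly R P Q)"
proof
  assume "pirreducible (carrier R) (quad_poly R P Q)"
  from pirreducibleE(3)[OF carrier_is_subring quad_poly_closed[OF assms(1,2)] this _ _ quad_poly_factor_root[OF assms]]
  have "[\<one>, \<ominus> x] \<in> Units (poly_ring R) \<or> [\<one>, \<ominus> (P \<ominus> x)] \<in> Units (poly_ring R)"
    using monic_linear_closed assms by simp
  then show False
    using univ_poly_carrier_units_incl by auto
qed

text \<open>If the square of \<open>t - \<theta>\<close> divides f, the cofactor has degree 0 and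
  leading coefficient 1, so f equals that square and coefficients can be compared. Conversely, the
  degree of f bounds the multiplicity by 2.\<close>

lemma (in domain) double_root_quad_poly_iff:
  assumes "P \<in> carrier R" "Q \<in> carrier R"
  shows "double_root R (quad_poly R P Q) \<theta> \<longleftrightarrow> \<theta> \<in> carrier R \<and> P = \<theta> \<oplus> \<theta> \<and> Q = \<theta> \<otimes> \<theta>"
proof -
  let ?p = "quad_poly R P Q"
  have p: "?p \<in> carrier (poly_ring R)" "?p \<noteq> []"
    using quad_poly_closed assms by (auto simp: quad_poly_def)
  interpret UP: domain "poly_ring R"
    using univ_poly_is_domain[OF carrier_is_subring] .
  have sq: "[\<one>, \<ominus> \<theta>] [^]\<^bsub>poly_ring R\<^esub> (2::nat) = quad_poly R (\<theta> \<oplus> \<theta>) (\<theta> \<otimes> \<theta>)" if "\<theta> \<in> carrier R"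
    using that linear_mult_linear[of \<theta> \<theta>] monic_linear_closed[of \<theta>] by (simp add: numeral_2_eq_2)
  show ?thesis
  proof
    assume "double_root R ?p \<theta>"
    then have \<theta>: "\<theta> \<in> carrier R" and "alg_mult ?p \<theta> = 2"
      by (simp_all add: double_root_def)
    then have "quad_poly R (\<theta> \<oplus> \<theta>) (\<theta> \<otimes> \<theta>) pdivides ?p"
      using alg_multE(1)[OF \<theta> p] sq by simp
    then obtain g where g: "g \<in> carrier (poly_ring R)"
      and eq: "?p = quad_poly R (\<theta> \<oplus> \<theta>) (\<theta> \<otimes> \<theta>) \<otimes>\<^bsub>poly_ring R\<^esub> g"
      unfolding pdivides_def factor_def by blast
    have q: "quad_poly R (\<theta> \<oplus> \<theta>) (\<theta> \<otimes> \<theta>) \<in> carrier (poly_ring R)" "quad_poly R (\<theta> \<oplus> \<theta>) (\<theta> \<otimes> \<theta>) \<noteq> []"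
      using quad_poly_closed \<theta> by (auto simp: quad_poly_def)
    have "g \<noteq> []"
      using eq p(2) UP.r_null[OF q(1)] by (auto simp: univ_poly_zero)
    note dl = poly_ring_mult_degree_lead_coeff[OF q(1) g q(2) this, folded eq]
    have "lead_coeff g \<in> carrier R"
      using g \<open>g \<noteq> []\<close> by (auto simp: univ_poly_def polynomial_def)
    then have "degree g = 0" "lead_coeff g = \<one>"
      using dl g \<open>g \<noteq> []\<close> \<theta> by (auto simp: quad_poly_def univ_poly_def polynomial_def)
    then have "g = [\<one>]"
      using \<open>g \<noteq> []\<close> by (cases g) auto
    then have "?p = quad_poly R (\<theta> \<oplus> \<theta>) (\<theta> \<otimes> \<theta>)"
      using eq UP.r_one[OF q(1)] by (simp add: univ_poly_one)
    then show "\<theta> \<in> carrier R \<and> P = \<theta> \<oplus> \<theta> \<and> Q = \<theta> \<otimes> \<theta>"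
      using quad_poly_inj[of P Q "\<theta> \<oplus> \<theta>"] assms \<theta> by blast
  next
    assume *: "\<theta> \<in> carrier R \<and> P = \<theta> \<oplus> \<theta> \<and> Q = \<theta> \<otimes> \<theta>"
    then have \<theta>: "\<theta> \<in> carrier R" ..
    have "[\<one>, \<ominus> \<theta>] [^]\<^bsub>poly_ring R\<^esub> (2::nat) pdivides ?p"
      using sq[OF \<theta>] * p UP.divides_refl by (simp add: pdivides_def)
    then have "2 \<le> alg_mult ?p \<theta>"
      using alg_multE(2)[OF \<theta> p] by blast
    moreover have "alg_mult ?p \<theta> \<le> 2"
      using pdivides_imp_degree_le[OF carrier_is_subring _ p alg_multE(1)[OF \<theta> p]]
        polynomial_pow_degree[OF monic_linear_closed[OF \<theta>], of "alg_mult ?p \<theta>"]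
        monic_linear_closed[OF \<theta>] by (simp add: quad_poly_def)
    ultimately show "double_root R ?p \<theta>"
      using \<theta> by (simp add: double_root_def)
  qed
qed

subsection \<open>Integral closedness of factorial domains\<close>

text \<open>The rational root argument with \<open>a / b\<close> a root of the monic f, by induction
  on a list of irreducible factors of b. An irreducible p dividing b divides \<open>a a\<close>,
  hence a because irreducibles are prime; p is removed from both a and b.\<close>

lemma (in factorial_domain) multlist_divides_of_quadratic_relation:
  assumes PQ: "P \<in> carrier R" "Q \<in> carrier R"
  shows "set fs \<subseteq> carrier (mult_of R) \<Longrightarrow> \<forall>p\<in>set fs. irreducible (mult_of R) p \<Longrightarrow> a \<in> carrier R \<Longrightarrow>
    b = foldr (\<otimes>) fs \<one> \<Longrightarrow> a \<otimes> a \<ominus> P \<otimes> (a \<otimes> b) \<oplus> Q \<otimes> (b \<otimes> b) = \<zero> \<Longrightarrow> b divides a"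
proof (induction fs arbitrary: a b)
  case Nil
  then show ?case
    using one_divides by simp
next
  case (Cons p fs)
  let ?b = "foldr (\<otimes>) fs \<one>"
  have a: "a \<in> carrier R" and p: "p \<in> carrier R" "p \<noteq> \<zero>"
    using Cons.prems by auto
  have b': "?b \<in> carrier R"
    using Cons.prems(1) by (induction fs) auto
  have b: "b = p \<otimes> ?b"
    using Cons.prems(4) by simp
  have "prime R p"
    using irreducible_prime[of p] Cons.prems(1,2) prime_eq_prime_mult[OF p(1)] by simp
  \<comment> \<open>The relation reads \<open>a a = b (P a - Q b)\<close>, and p is a factor of
    b.\<close>
  moreover have "p divides a \<otimes> a"
  proof (rule dividesI)
    have "a \<otimes> a = (a \<otimes> a \<ominus> P \<otimes> (a \<otimes> b) \<oplus> Q \<otimes> (b \<otimes> b)) \<oplus> p \<otimes> (?b \<otimes> (P \<otimes> a \<ominus> Q \<otimes> b))"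
      unfolding b using a p(1) b' PQ by algebra
    then show "a \<otimes> a = p \<otimes> (?b \<otimes> (P \<otimes> a \<ominus> Q \<otimes> b))"
      unfolding Cons.prems(5) using a p(1) b' PQ by (simp add: b)
  qed (use a p(1) b' PQ in \<open>simp add: b\<close>)
  ultimately have "p divides a"
    using a unfolding prime_def by blast
  then obtain a' where a': "a' \<in> carrier R" "a = p \<otimes> a'"
    unfolding factor_def by blast
  let ?z = "a' \<otimes> a' \<ominus> P \<otimes> (a' \<otimes> ?b) \<oplus> Q \<otimes> (?b \<otimes> ?b)"
  have z: "?z \<in> carrier R"
    using a' b' PQ by simp
  \<comment> \<open>The relation is homogeneous of degree 2 in a and b, so dividing both by p
    divides it by \<open>p p\<close>.\<close>
  have "p \<otimes> (p \<otimes> ?z) = a \<otimes> a \<ominus> P \<otimes> (a \<otimes> b) \<oplus> Q \<otimes> (b \<otimes> b)"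
    unfolding b a'(2) using a'(1) p(1) b' PQ by algebra
  then have "?z = \<zero>"
    unfolding Cons.prems(5) using z p by (simp add: integral_iff)
  then have "?b divides a'"
    using Cons.IH[OF _ _ a'(1) refl] Cons.prems(1,2) by simp
  then show "b divides a"
    unfolding b a'(2) by (rule divides_mult[OF b' p(1)])
qed

text \<open>A unit divides everything, and \<open>factors_exist\<close> provides the list of
  irreducible factors for the other nonzero denominators.\<close>

lemma (in factorial_domain) divides_of_quadratic_relation:
  assumes "P \<in> carrier R" "Q \<in> carrier R" "a \<in> carrier R" "b \<in> carrier R" "b \<noteq> \<zero>"
    and "a \<otimes> a \<ominus> P \<otimes> (a \<otimes> b) \<oplus> Q \<otimes> (b \<otimes> b) = \<zero>"
  shows "b divides a"
proof (cases "b \<in> Units R")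
  case True
  then show ?thesis
    using unit_divides assms(3) by blast
next
  case False
  then obtain fs where "set fs \<subseteq> carrier (mult_of R)" "factors (mult_of R) fs b"
    using factors_exist[of b] assms(4,5) Units_mult_eq_Units by auto
  then show ?thesis
    using multlist_divides_of_quadratic_relation[OF assms(1,2) _ _ assms(3) _ assms(6), of fs]
    by (auto simp: factors_def)
qed

subsection \<open>The irreducible case\<close>

text \<open>The roots are described by Vieta's relations, so the images of P and Q can be rewritten
  in \<theta>1 and \<theta>2 before an identity is checked.\<close>

locale quad_roots_field = R: factorial_domain R + L: field L
  for R :: "('a, 'm) ring_scheme" and L :: "('b, 'n) ring_scheme" +
  fixes \<iota> :: "'a \<Rightarrow> 'b" and P Q :: 'a and \<theta>1 \<theta>2 :: 'b
  assumes \<iota>: "\<iota> \<in> ring_hom R L" "inj_on \<iota> (carrier R)"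
    and PQ: "P \<in> carrier R" "Q \<in> carrier R"
    and \<theta>: "\<theta>1 \<in> carrier L" "\<theta>2 \<in> carrier L" "\<theta>1 \<oplus>\<^bsub>L\<^esub> \<theta>2 = \<iota> P" "\<theta>1 \<otimes>\<^bsub>L\<^esub> \<theta>2 = \<iota> Q"
begin

sublocale \<iota>: ring_hom_cring R L \<iota>
  by unfold_locales (rule \<iota>(1))

lemma \<iota>_minus: "a \<in> carrier R \<Longrightarrow> b \<in> carrier R \<Longrightarrow> \<iota> (a \<ominus>\<^bsub>R\<^esub> b) = \<iota> a \<ominus>\<^bsub>L\<^esub> \<iota> b"
  by (simp add: a_minus_def)

lemma \<iota>_eqD: "\<iota> a = \<iota> b \<Longrightarrow> a \<in> carrier R \<Longrightarrow> b \<in> carrier R \<Longrightarrow> a = b"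
  using \<iota>(2) by (rule inj_onD)

lemma \<iota>_eq_zeroD: "\<iota> a = \<zero>\<^bsub>L\<^esub> \<Longrightarrow> a \<in> carrier R \<Longrightarrow> a = \<zero>\<^bsub>R\<^esub>"
  using \<iota>_eqD[of a "\<zero>\<^bsub>R\<^esub>"] by simp

lemma \<theta>1_root: "\<theta>1 \<otimes>\<^bsub>L\<^esub> \<theta>1 \<oplus>\<^bsub>L\<^esub> \<iota> Q = \<iota> P \<otimes>\<^bsub>L\<^esub> \<theta>1"
  unfolding \<theta>(3,4)[symmetric] using \<theta>(1,2) by algebra

abbreviation \<psi>1 :: "'a \<times> 'a \<Rightarrow> 'b"
  where "\<psi>1 \<equiv> \<lambda>(a1, a0). \<iota> a1 \<ominus>\<^bsub>L\<^esub> \<iota> a0 \<otimes>\<^bsub>L\<^esub> \<theta>1"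

abbreviation ext :: "'b set"
  where "ext \<equiv> ring.simple_extension L (\<iota> ` carrier R) \<theta>1"

lemma subring_image: "subring (\<iota> ` carrier R) L"
  using ring_hom_ring.img_is_subring[OF ring_hom_ringI2[OF R.ring_axioms L.ring_axioms \<iota>(1)] R.carrier_is_subring] .

lemma subring_ext: "subring ext L"
  using L.simple_extension_is_subring[OF subring_image \<theta>(1)] .

lemma ext_generators: "\<iota> ` carrier R \<subseteq> ext" "\<theta>1 \<in> ext"
  by (rule L.simple_extension_incl[OF subringE(1)[OF subring_image] \<theta>(1)],
      rule L.simple_extension_mem[OF subring_image \<theta>(1)])

text \<open>The simple extension is generated from zero by Horner steps
  \<open>k1 \<theta>1 + k2\<close>. It suffices that the elements of the form
  \<open>a - b \<theta>1\<close> are closed under such a step.\<close>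

lemma \<psi>1_image: "\<psi>1 ` (carrier R \<times> carrier R) = ext"
proof
  have "\<iota> a \<ominus>\<^bsub>L\<^esub> \<iota> b \<otimes>\<^bsub>L\<^esub> \<theta>1 \<in> ext" if "a \<in> carrier R" "b \<in> carrier R" for a b
    unfolding a_minus_def using that ext_generators
    by (intro subringE(5,6,7)[OF subring_ext]) auto
  then show "\<psi>1 ` (carrier R \<times> carrier R) \<subseteq> ext"
    by auto
  show "ext \<subseteq> \<psi>1 ` (carrier R \<times> carrier R)"
  proof
    fix z assume "z \<in> ext"
    then show "z \<in> \<psi>1 ` (carrier R \<times> carrier R)"
    proof (induction rule: L.simple_extension.induct)
      case zero
      have "\<psi>1 (\<zero>\<^bsub>R\<^esub>, \<zero>\<^bsub>R\<^esub>) = \<zero>\<^bsub>L\<^esub>"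
        using \<theta>(1) by simp
      then show ?case
        by (metis R.zero_closed SigmaI image_eqI)
    next
      case (lin k1 k2)
      then obtain a b c where abc: "a \<in> carrier R" "b \<in> carrier R" "c \<in> carrier R"
        and k: "k1 = \<psi>1 (a, b)" "k2 = \<iota> c"
        by auto
      let ?A = "\<iota> a" and ?B = "\<iota> b" and ?C = "\<iota> c"
      have ABC: "?A \<in> carrier L" "?B \<in> carrier L" "?C \<in> carrier L"
        using abc by simp_all
      \<comment> \<open>The square of \<theta>1 is replaced by \<open>P \<theta>1 - Q\<close>, so a
        Horner step from \<open>a - b \<theta>1\<close> gives
        \<open>(c + b Q) - (b P - a) \<theta>1\<close>.\<close>
      have "(?A \<ominus>\<^bsub>L\<^esub> ?B \<otimes>\<^bsub>L\<^esub> \<theta>1) \<otimes>\<^bsub>L\<^esub> \<theta>1 \<oplus>\<^bsub>L\<^esub> ?C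
          = (?C \<oplus>\<^bsub>L\<^esub> ?B \<otimes>\<^bsub>L\<^esub> (\<theta>1 \<otimes>\<^bsub>L\<^esub> \<theta>2)) \<ominus>\<^bsub>L\<^esub> (?B \<otimes>\<^bsub>L\<^esub> (\<theta>1 \<oplus>\<^bsub>L\<^esub> \<theta>2) \<ominus>\<^bsub>L\<^esub> ?A) \<otimes>\<^bsub>L\<^esub> \<theta>1"
        using ABC \<theta>(1,2) by algebra
      then have "k1 \<otimes>\<^bsub>L\<^esub> \<theta>1 \<oplus>\<^bsub>L\<^esub> k2 = \<psi>1 (c \<oplus>\<^bsub>R\<^esub> b \<otimes>\<^bsub>R\<^esub> Q, b \<otimes>\<^bsub>R\<^esub> P \<ominus>\<^bsub>R\<^esub> a)"
        using abc PQ by (simp add: k \<theta>(3,4) \<iota>_minus)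
      moreover have "(c \<oplus>\<^bsub>R\<^esub> b \<otimes>\<^bsub>R\<^esub> Q, b \<otimes>\<^bsub>R\<^esub> P \<ominus>\<^bsub>R\<^esub> a) \<in> carrier R \<times> carrier R"
        using abc PQ by simp
      ultimately show ?case
        by (rule image_eqI)
    qed
  qed
qed

lemma \<psi>1_inj:
  assumes irr: "pirreducible\<^bsub>R\<^esub> (carrier R) (quad_poly R P Q)"
  shows "inj_on \<psi>1 (carrier R \<times> carrier R)"
proof (rule inj_onI, clarify)
  fix a b c d
  assume car: "a \<in> carrier R" "b \<in> carrier R" "c \<in> carrier R" "d \<in> carrier R"
    and eq: "\<iota> a \<ominus>\<^bsub>L\<^esub> \<iota> b \<otimes>\<^bsub>L\<^esub> \<theta>1 = \<iota> c \<ominus>\<^bsub>L\<^esub> \<iota> d \<otimes>\<^bsub>L\<^esub> \<theta>1"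
  define e where "e = b \<ominus>\<^bsub>R\<^esub> d"
  define g where "g = a \<ominus>\<^bsub>R\<^esub> c"
  have eg: "e \<in> carrier R" "g \<in> carrier R"
    using car by (simp_all add: e_def g_def)
  have \<iota>eg: "\<iota> e \<in> carrier L" "\<iota> g \<in> carrier L"
    using eg by simp_all
  have "\<iota> a \<ominus>\<^bsub>L\<^esub> \<iota> c = (\<iota> a \<ominus>\<^bsub>L\<^esub> \<iota> b \<otimes>\<^bsub>L\<^esub> \<theta>1) \<ominus>\<^bsub>L\<^esub> (\<iota> c \<ominus>\<^bsub>L\<^esub> \<iota> d \<otimes>\<^bsub>L\<^esub> \<theta>1) \<oplus>\<^bsub>L\<^esub> (\<iota> b \<ominus>\<^bsub>L\<^esub> \<iota> d) \<otimes>\<^bsub>L\<^esub> \<theta>1"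
    using car[THEN \<iota>.hom_closed] \<theta>(1) by algebra
  also have "\<dots> = (\<iota> b \<ominus>\<^bsub>L\<^esub> \<iota> d) \<otimes>\<^bsub>L\<^esub> \<theta>1"
    unfolding eq using car[THEN \<iota>.hom_closed] \<theta>(1) by simp
  finally have ge: "\<iota> g = \<iota> e \<otimes>\<^bsub>L\<^esub> \<theta>1"
    using car by (simp add: e_def g_def \<iota>_minus)
  have "e = \<zero>\<^bsub>R\<^esub>"
  proof (rule ccontr)
    assume e0: "e \<noteq> \<zero>\<^bsub>R\<^esub>"
    let ?E = "\<iota> e"
    \<comment> \<open>Since g equals \<open>e \<theta>1\<close> in L, this is the equation of
      \<theta>1 multiplied by \<open>e e\<close>. The denominator is cleared, and the relation
      descends to R by injectivity of the embedding.\<close>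
    have "\<iota> (g \<otimes>\<^bsub>R\<^esub> g \<ominus>\<^bsub>R\<^esub> P \<otimes>\<^bsub>R\<^esub> (g \<otimes>\<^bsub>R\<^esub> e) \<oplus>\<^bsub>R\<^esub> Q \<otimes>\<^bsub>R\<^esub> (e \<otimes>\<^bsub>R\<^esub> e))
        = (?E \<otimes>\<^bsub>L\<^esub> \<theta>1) \<otimes>\<^bsub>L\<^esub> (?E \<otimes>\<^bsub>L\<^esub> \<theta>1) \<ominus>\<^bsub>L\<^esub> (\<theta>1 \<oplus>\<^bsub>L\<^esub> \<theta>2) \<otimes>\<^bsub>L\<^esub> ((?E \<otimes>\<^bsub>L\<^esub> \<theta>1) \<otimes>\<^bsub>L\<^esub> ?E) \<oplus>\<^bsub>L\<^esub> (\<theta>1 \<otimes>\<^bsub>L\<^esub> \<theta>2) \<otimes>\<^bsub>L\<^esub> (?E \<otimes>\<^bsub>L\<^esub> ?E)"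
      using eg PQ by (simp add: \<iota>_minus ge \<theta>(3,4))
    also have "\<dots> = \<zero>\<^bsub>L\<^esub>"
      using \<iota>eg(1) \<theta>(1,2) by algebra
    finally have "g \<otimes>\<^bsub>R\<^esub> g \<ominus>\<^bsub>R\<^esub> P \<otimes>\<^bsub>R\<^esub> (g \<otimes>\<^bsub>R\<^esub> e) \<oplus>\<^bsub>R\<^esub> Q \<otimes>\<^bsub>R\<^esub> (e \<otimes>\<^bsub>R\<^esub> e) = \<zero>\<^bsub>R\<^esub>"
      by (rule \<iota>_eq_zeroD) (use eg PQ in simp)
    then have "e divides\<^bsub>R\<^esub> g"
      using R.divides_of_quadratic_relation PQ eg e0 by blast
    then obtain x where x: "x \<in> carrier R" "g = e \<otimes>\<^bsub>R\<^esub> x"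
      unfolding factor_def by blast
    have "\<iota> e \<noteq> \<zero>\<^bsub>L\<^esub>"
      using \<iota>_eq_zeroD eg(1) e0 by blast
    moreover have "\<iota> e \<otimes>\<^bsub>L\<^esub> \<iota> x = \<iota> e \<otimes>\<^bsub>L\<^esub> \<theta>1"
      using ge x eg by simp
    ultimately have \<iota>x: "\<iota> x = \<theta>1"
      using L.m_lcancel[of "\<iota> e"] \<iota>eg(1) x(1) \<theta>(1) by simp
    have "\<iota> (x \<otimes>\<^bsub>R\<^esub> x \<ominus>\<^bsub>R\<^esub> P \<otimes>\<^bsub>R\<^esub> x \<oplus>\<^bsub>R\<^esub> Q)
        = \<theta>1 \<otimes>\<^bsub>L\<^esub> \<theta>1 \<ominus>\<^bsub>L\<^esub> (\<theta>1 \<oplus>\<^bsub>L\<^esub> \<theta>2) \<otimes>\<^bsub>L\<^esub> \<theta>1 \<oplus>\<^bsub>L\<^esub> \<theta>1 \<otimes>\<^bsub>L\<^esub> \<theta>2"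
      using x(1) PQ by (simp add: \<iota>_minus \<iota>x \<theta>(3,4))
    also have "\<dots> = \<zero>\<^bsub>L\<^esub>"
      using \<theta>(1,2) by algebra
    finally have "x \<otimes>\<^bsub>R\<^esub> x \<ominus>\<^bsub>R\<^esub> P \<otimes>\<^bsub>R\<^esub> x \<oplus>\<^bsub>R\<^esub> Q = \<zero>\<^bsub>R\<^esub>"
      by (rule \<iota>_eq_zeroD) (use x(1) PQ in simp)
    then show False
      using R.root_imp_not_pirreducible PQ x(1) irr by blast
  qed
  moreover from this have "g = \<zero>\<^bsub>R\<^esub>"
    using ge \<theta>(1) \<iota>_eq_zeroD[OF _ eg(2)] by simp
  ultimately show "a = c \<and> b = d"
    using car by (simp add: e_def g_def)
qed

lemma irreducible_case:
  assumes irr: "pirreducible\<^bsub>R\<^esub> (carrier R) (quad_poly R P Q)"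
  shows "algebra R (adjoin R L \<iota> \<theta>1)"
    and "\<psi>1 \<in> algebra_iso R (vec_alg R P Q) (adjoin R L \<iota> \<theta>1)"
    and "\<psi>1 \<in> iso (units_of (vec_alg R P Q)) (units_of (adjoin R L \<iota> \<theta>1))"
proof -
  let ?S = "L\<lparr>carrier := ext\<rparr>"
  interpret S: domain ?S
    by (rule L.subring_is_domain[OF subring_ext])
  \<comment> \<open>The target has the operations of L on a smaller carrier, so the equations
    verified in L are the required ones.\<close>
  interpret quad_root R ?S \<iota> P Q \<theta>1 \<psi>1
  proof
    show "\<iota> \<in> ring_hom R ?S"
      using ext_generators(1) by (intro ring_hom_memI) auto
    show "\<psi>1 (a, b) \<in> carrier ?S" if "a \<in> carrier R" "b \<in> carrier R" for a b
      using \<psi>1_image that by force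
    show "\<psi>1 (a, b) \<oplus>\<^bsub>?S\<^esub> \<iota> b \<otimes>\<^bsub>?S\<^esub> \<theta>1 = \<iota> a" if "a \<in> carrier R" "b \<in> carrier R" for a b
      using that \<theta>(1) by (simp add: a_minus_def L.a_assoc L.l_neg)
  qed (use PQ ext_generators(2) \<theta>1_root in simp_all)
  have "bij_betw \<psi>1 (carrier R \<times> carrier R) (carrier ?S)"
    using \<psi>1_inj[OF irr] \<psi>1_image by (simp add: bij_betw_def)
  from \<psi>_iso[OF this]
  show "algebra R (adjoin R L \<iota> \<theta>1)"
    and "\<psi>1 \<in> algebra_iso R (vec_alg R P Q) (adjoin R L \<iota> \<theta>1)"
    and "\<psi>1 \<in> iso (units_of (vec_alg R P Q)) (units_of (adjoin R L \<iota> \<theta>1))"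
    by (simp_all add: adjoin_def)
qed

text \<open>For a root x of f in R, the product of \<open>x - \<theta>1\<close> and
  \<open>x - \<theta>2\<close> vanishes in L, so x is one of the two and \<open>P - x\<close> is the
  other. Both cases occur; the distinction keeps r1 over \<theta>1 and r2 over \<theta>2.\<close>

lemma reducible_roots:
  assumes "\<not> pirreducible\<^bsub>R\<^esub> (carrier R) (quad_poly R P Q)"
  obtains r1 r2 where "r1 \<in> carrier R" "r2 \<in> carrier R" "\<iota> r1 = \<theta>1" "\<iota> r2 = \<theta>2"
    "r1 \<oplus>\<^bsub>R\<^esub> r2 = P" "r1 \<otimes>\<^bsub>R\<^esub> r2 = Q"
proof -
  obtain x where x: "x \<in> carrier R" "x \<otimes>\<^bsub>R\<^esub> x \<ominus>\<^bsub>R\<^esub> P \<otimes>\<^bsub>R\<^esub> x \<oplus>\<^bsub>R\<^esub> Q = \<zero>\<^bsub>R\<^esub>"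
    using R.reducible_quad_poly[OF PQ assms] by blast
  let ?y = "P \<ominus>\<^bsub>R\<^esub> x"
  have y: "?y \<in> carrier R" "\<iota> ?y = (\<theta>1 \<oplus>\<^bsub>L\<^esub> \<theta>2) \<ominus>\<^bsub>L\<^esub> \<iota> x"
    using x(1) PQ by (simp_all add: \<iota>_minus \<theta>(3))
  have "(\<iota> x \<ominus>\<^bsub>L\<^esub> \<theta>1) \<otimes>\<^bsub>L\<^esub> (\<iota> x \<ominus>\<^bsub>L\<^esub> \<theta>2)
      = \<iota> x \<otimes>\<^bsub>L\<^esub> \<iota> x \<ominus>\<^bsub>L\<^esub> (\<theta>1 \<oplus>\<^bsub>L\<^esub> \<theta>2) \<otimes>\<^bsub>L\<^esub> \<iota> x \<oplus>\<^bsub>L\<^esub> \<theta>1 \<otimes>\<^bsub>L\<^esub> \<theta>2"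
    using x(1)[THEN \<iota>.hom_closed] \<theta>(1,2) by algebra
  also have "\<dots> = \<iota> (x \<otimes>\<^bsub>R\<^esub> x \<ominus>\<^bsub>R\<^esub> P \<otimes>\<^bsub>R\<^esub> x \<oplus>\<^bsub>R\<^esub> Q)"
    using x(1) PQ by (simp add: \<iota>_minus \<theta>(3,4))
  finally have "(\<iota> x \<ominus>\<^bsub>L\<^esub> \<theta>1) \<otimes>\<^bsub>L\<^esub> (\<iota> x \<ominus>\<^bsub>L\<^esub> \<theta>2) = \<zero>\<^bsub>L\<^esub>"
    unfolding x(2) by simp
  then have "\<iota> x = \<theta>1 \<or> \<iota> x = \<theta>2"
    using L.integral[of "\<iota> x \<ominus>\<^bsub>L\<^esub> \<theta>1" "\<iota> x \<ominus>\<^bsub>L\<^esub> \<theta>2"] x(1) \<theta>(1,2) by simp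
  then obtain r1 r2 where r: "r1 \<in> carrier R" "r2 \<in> carrier R" "\<iota> r1 = \<theta>1" "\<iota> r2 = \<theta>2"
  proof
    assume 1: "\<iota> x = \<theta>1"
    have "(\<theta>1 \<oplus>\<^bsub>L\<^esub> \<theta>2) \<ominus>\<^bsub>L\<^esub> \<theta>1 = \<theta>2"
      using \<theta>(1,2) by algebra
    then show thesis
      using that[of x ?y] x(1) y 1 by simp
  next
    assume 2: "\<iota> x = \<theta>2"
    have "(\<theta>1 \<oplus>\<^bsub>L\<^esub> \<theta>2) \<ominus>\<^bsub>L\<^esub> \<theta>2 = \<theta>1"
      using \<theta>(1,2) by algebra
    then show thesis
      using that[of ?y x] x(1) y 2 by simp
  qed
  have "\<iota> (r1 \<oplus>\<^bsub>R\<^esub> r2) = \<iota> P" "\<iota> (r1 \<otimes>\<^bsub>R\<^esub> r2) = \<iota> Q"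
    using r \<theta>(3,4) by simp_all
  then have "r1 \<oplus>\<^bsub>R\<^esub> r2 = P" "r1 \<otimes>\<^bsub>R\<^esub> r2 = Q"
    using r(1,2) PQ by (auto dest: \<iota>_eqD simp del: \<iota>.hom_add \<iota>.hom_mult)
  with r show thesis
    by (rule that)
qed

end

subsection \<open>Distinct roots\<close>

lemma (in cring) congr_mod_iff:
  "congr_mod R s x y \<longleftrightarrow> (\<exists>k\<in>carrier R. x \<ominus> y = k \<otimes> s)"
  by (auto simp: congr_mod_def cgenideal_def)

lemma RDirProd_simps [simp]:
  "x \<otimes>\<^bsub>RDirProd R R\<^esub> y = (fst x \<otimes>\<^bsub>R\<^esub> fst y, snd x \<otimes>\<^bsub>R\<^esub> snd y)"
  "x \<oplus>\<^bsub>RDirProd R R\<^esub> y = (fst x \<oplus>\<^bsub>R\<^esub> fst y, snd x \<oplus>\<^bsub>R\<^esub> snd y)"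
  "\<one>\<^bsub>RDirProd R R\<^esub> = (\<one>\<^bsub>R\<^esub>, \<one>\<^bsub>R\<^esub>)"
  "\<zero>\<^bsub>RDirProd R R\<^esub> = (\<zero>\<^bsub>R\<^esub>, \<zero>\<^bsub>R\<^esub>)"
  by (simp_all add: RDirProd_def DirProd_def monoid.defs split: prod.splits)

context cring
begin

context
  fixes s
  assumes s: "s \<in> carrier R"
begin

lemma congr_mod_refl: "x \<in> carrier R \<Longrightarrow> congr_mod R s x x"
  using s by (auto simp: congr_mod_iff intro!: bexI[of _ \<zero>])

lemma congr_mod_add:
  assumes "congr_mod R s x y" "congr_mod R s x' y'"
    and "x \<in> carrier R" "y \<in> carrier R" "x' \<in> carrier R" "y' \<in> carrier R"
  shows "congr_mod R s (x \<oplus> x') (y \<oplus> y')"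
proof -
  obtain k k' where k: "k \<in> carrier R" "k' \<in> carrier R" "x \<ominus> y = k \<otimes> s" "x' \<ominus> y' = k' \<otimes> s"
    using assms(1,2) by (auto simp: congr_mod_iff)
  have "(x \<oplus> x') \<ominus> (y \<oplus> y') = (x \<ominus> y) \<oplus> (x' \<ominus> y')"
    using assms(3-) by algebra
  also have "\<dots> = (k \<oplus> k') \<otimes> s"
    unfolding k(3,4) using k(1,2) s by algebra
  finally show ?thesis
    using k(1,2) by (auto simp: congr_mod_iff)
qed

lemma congr_mod_mult:
  assumes "congr_mod R s x y" "congr_mod R s x' y'"
    and "x \<in> carrier R" "y \<in> carrier R" "x' \<in> carrier R" "y' \<in> carrier R"
  shows "congr_mod R s (x \<otimes> x') (y \<otimes> y')"
proof -
  obtain k k' where k: "k \<in> carrier R" "k' \<in> carrier R" "x \<ominus> y = k \<otimes> s" "x' \<ominus> y' = k' \<otimes> s"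
    using assms(1,2) by (auto simp: congr_mod_iff)
  have "(x \<otimes> x') \<ominus> (y \<otimes> y') = (x \<ominus> y) \<otimes> x' \<oplus> y \<otimes> (x' \<ominus> y')"
    using assms(3-) by algebra
  also have "\<dots> = (k \<otimes> x' \<oplus> y \<otimes> k') \<otimes> s"
    unfolding k(3,4) using k(1,2) s assms(3-) by algebra
  finally show ?thesis
    using k(1,2) assms(3-) by (auto simp: congr_mod_iff)
qed

lemma congr_mod_minus:
  assumes "congr_mod R s x y" "x \<in> carrier R" "y \<in> carrier R"
  shows "congr_mod R s (\<ominus> x) (\<ominus> y)"
proof -
  have "congr_mod R s (\<ominus> \<one> \<otimes> x) (\<ominus> \<one> \<otimes> y)"
    using assms by (intro congr_mod_mult congr_mod_refl) simp_all
  then show ?thesis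
    using assms by (simp add: l_minus)
qed

text \<open>From \<open>1/x - 1/y = - (x - y) / (x y)\<close>. Hence a congruent pair of units of R
  has its inverse in the ring of congruent pairs.\<close>

lemma congr_mod_inv:
  assumes "congr_mod R s x y" "x \<in> Units R" "y \<in> Units R"
  shows "congr_mod R s (inv x) (inv y)"
proof -
  have c: "x \<in> carrier R" "y \<in> carrier R" "inv x \<in> carrier R" "inv y \<in> carrier R"
    using assms(2,3) by (simp_all add: Units_closed)
  obtain k where k: "k \<in> carrier R" "x \<ominus> y = k \<otimes> s"
    using assms(1) by (auto simp: congr_mod_iff)
  have "inv x \<ominus> inv y = inv x \<otimes> (y \<otimes> inv y) \<ominus> (x \<otimes> inv x) \<otimes> inv y"
    using assms(2,3) c by simp
  also have "\<dots> = \<ominus> (inv x \<otimes> inv y \<otimes> (x \<ominus> y))"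
    using c by algebra
  also have "\<dots> = (\<ominus> (inv x \<otimes> inv y \<otimes> k)) \<otimes> s"
    unfolding k(2) using c k(1) s by algebra
  finally show ?thesis
    using c k(1) by (auto simp: congr_mod_iff)
qed

lemma cring_congr_pairs:
  "cring ((RDirProd R R)\<lparr>carrier := {(x, y) \<in> carrier R \<times> carrier R. congr_mod R s x y}\<rparr>)"
    (is "cring ?S")
proof (rule cringI)
  show "abelian_group ?S"
  proof (rule abelian_groupI)
    fix x assume "x \<in> carrier ?S"
    then have "(\<ominus> fst x, \<ominus> snd x) \<in> carrier ?S" "(\<ominus> fst x, \<ominus> snd x) \<oplus>\<^bsub>?S\<^esub> x = \<zero>\<^bsub>?S\<^esub>"
      by (auto simp: congr_mod_minus l_neg)
    then show "\<exists>y\<in>carrier ?S. y \<oplus>\<^bsub>?S\<^esub> x = \<zero>\<^bsub>?S\<^esub>"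
      by blast
  qed (auto simp: congr_mod_add congr_mod_refl a_ac)
  show "comm_monoid ?S"
    by (rule comm_monoidI) (auto simp: congr_mod_mult congr_mod_refl m_ac)
qed (auto simp: l_distr)

lemma ring_hom_diagonal:
  "(\<lambda>r. (r, r)) \<in> ring_hom R
    ((RDirProd R R)\<lparr>carrier := {(x, y) \<in> carrier R \<times> carrier R. congr_mod R s x y}\<rparr>)"
  by (intro ring_hom_memI) (auto simp: congr_mod_refl)

lemma Units_congr_pairs_alg:
  "Units (congr_pairs_alg R s) = {(x, y) \<in> Units R \<times> Units R. congr_mod R s x y}" (is "_ = ?U")
proof
  show "Units (congr_pairs_alg R s) \<subseteq> ?U"
    by (auto simp: congr_pairs_alg_def Units_def)
  show "?U \<subseteq> Units (congr_pairs_alg R s)"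
  proof clarify
    fix x y assume xy: "x \<in> Units R" "y \<in> Units R" "congr_mod R s x y"
    have "(inv x, inv y) \<in> {(x, y) \<in> carrier R \<times> carrier R. congr_mod R s x y}"
      using congr_mod_inv[OF xy(3,1,2)] xy by simp
    then show "(x, y) \<in> Units (congr_pairs_alg R s)"
      using xy unfolding Units_def[of "congr_pairs_alg R s"] mem_Collect_eq
      by (intro conjI bexI[of _ "(inv x, inv y)"]) (simp_all add: congr_pairs_alg_def Units_closed)
  qed
qed

end

text \<open>Origin of the square root of d: when the roots lie in R, their difference is
  one.\<close>

lemma discr_eq:
  assumes "r1 \<in> carrier R" "r2 \<in> carrier R"
  shows "discr R (r1 \<oplus> r2) (r1 \<otimes> r2) = (r1 \<ominus> r2) [^] (2::nat)"
proof -
  let ?q = "r1 \<otimes> r2"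
  have "[(4::nat)] \<cdot> ?q = ?q \<oplus> ?q \<oplus> ?q \<oplus> ?q"
    using assms by (simp add: numeral_eq_Suc a_ac)
  moreover have "(r1 \<oplus> r2) \<otimes> (r1 \<oplus> r2) \<ominus> (?q \<oplus> ?q \<oplus> ?q \<oplus> ?q) = (r1 \<ominus> r2) \<otimes> (r1 \<ominus> r2)"
    using assms by algebra
  ultimately show ?thesis
    using assms by (simp add: discr_def nat_pow_2)
qed

end

text \<open>In a domain equal squares mean equality up to sign, and t and -t generate the same
  ideal. Thus H_R does not depend on the chosen square root of d.\<close>

lemma (in domain) congr_mod_cong_square:
  assumes "s \<in> carrier R" "t \<in> carrier R" "s \<otimes> s = t \<otimes> t"
  shows "congr_mod R s x y \<longleftrightarrow> congr_mod R t x y"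
proof -
  have "(s \<ominus> t) \<otimes> (s \<oplus> t) = s \<otimes> s \<ominus> t \<otimes> t"
    using assms(1,2) by algebra
  then have "(s \<ominus> t) \<otimes> (s \<oplus> t) = \<zero>"
    unfolding assms(3) using assms(2) by simp
  then have "s \<ominus> t = \<zero> \<or> s \<oplus> t = \<zero>"
    using integral[of "s \<ominus> t" "s \<oplus> t"] assms(1,2) by simp
  then have "s = t \<or> s = \<ominus> t"
    using assms(1,2) minus_equality by auto
  moreover have "congr_mod R (\<ominus> t) x y \<longleftrightarrow> congr_mod R t x y"
  proof
    assume "congr_mod R (\<ominus> t) x y"
    then obtain k where "k \<in> carrier R" "x \<ominus> y = k \<otimes> \<ominus> t"
      by (auto simp: congr_mod_iff)
    then show "congr_mod R t x y"
      using assms(2) by (auto simp: congr_mod_iff l_minus r_minus intro!: bexI[of _ "\<ominus> k"])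
  next
    assume "congr_mod R t x y"
    then obtain k where "k \<in> carrier R" "x \<ominus> y = k \<otimes> t"
      by (auto simp: congr_mod_iff)
    then show "congr_mod R (\<ominus> t) x y"
      using assms(2) by (auto simp: congr_mod_iff l_minus r_minus intro!: bexI[of _ "\<ominus> k"])
  qed
  ultimately show ?thesis
    by auto
qed

lemma (in domain) distinct_roots_case:
  assumes r: "r1 \<in> carrier R" "r2 \<in> carrier R" "r1 \<noteq> r2"
    and P: "r1 \<oplus> r2 = P" and Q: "r1 \<otimes> r2 = Q"
    and s: "s \<in> carrier R" "s [^] (2::nat) = discr R P Q"
  defines "\<psi> \<equiv> \<lambda>(a1, a0). (a1 \<ominus> a0 \<otimes> r1, a1 \<ominus> a0 \<otimes> r2)"
  shows "algebra R (congr_pairs_alg R s)"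
    and "\<psi> \<in> algebra_iso R (vec_alg R P Q) (congr_pairs_alg R s)"
    and "\<psi> \<in> iso (units_of (vec_alg R P Q)) (units_of (congr_pairs_alg R s))"
    and "discr R P Q \<in> Units R \<Longrightarrow> carrier (congr_pairs_alg R s) = carrier R \<times> carrier R"
proof -
  let ?d = "r1 \<ominus> r2"
  let ?H = "{(x, y) \<in> carrier R \<times> carrier R. congr_mod R s x y}"
  let ?S = "(RDirProd R R)\<lparr>carrier := ?H\<rparr>"
  have d: "?d \<in> carrier R" "?d \<noteq> \<zero>"
    using r by simp_all
  have PQ: "P \<in> carrier R" "Q \<in> carrier R"
    using r P Q by auto
  \<comment> \<open>From here on congruence modulo s is replaced by congruence modulo the difference
    of the roots, for which the image of \<psi> can be computed.\<close>
  have "s \<otimes> s = ?d \<otimes> ?d"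
    using s discr_eq[OF r(1,2)] r by (simp add: P Q nat_pow_2)
  from congr_mod_cong_square[OF s(1) d(1) this]
  have congr: "congr_mod R s x y \<longleftrightarrow> (\<exists>k\<in>carrier R. x \<ominus> y = k \<otimes> ?d)" for x y
    unfolding congr_mod_iff[symmetric] .
  have mem: "\<psi> (a, b) \<in> ?H" if "a \<in> carrier R" "b \<in> carrier R" for a b
  proof -
    have "a \<ominus> b \<otimes> r1 \<ominus> (a \<ominus> b \<otimes> r2) = \<ominus> b \<otimes> ?d"
      using that r(1,2) by algebra
    then show ?thesis
      using that r by (auto simp: \<psi>_def congr)
  qed
  interpret S: cring ?S
    by (rule cring_congr_pairs[OF s(1)])
  \<comment> \<open>Here \<tau> is the pair of roots, a zero of f in each component, and it lies in
    H_R because its components differ by one times \<open>r1 - r2\<close>.\<close>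
  interpret quad_root R ?S "\<lambda>r. (r, r)" P Q "(r1, r2)" \<psi>
  proof
    show "(\<lambda>r. (r, r)) \<in> ring_hom R ?S"
      by (rule ring_hom_diagonal[OF s(1)])
    have "congr_mod R s r1 r2"
      using d unfolding congr by (intro bexI[of _ \<one>]) simp_all
    then show "(r1, r2) \<in> carrier ?S"
      using r by simp
    have "r1 \<otimes> r1 \<oplus> r1 \<otimes> r2 = (r1 \<oplus> r2) \<otimes> r1" "r2 \<otimes> r2 \<oplus> r1 \<otimes> r2 = (r1 \<oplus> r2) \<otimes> r2"
      using r(1,2) by algebra+
    then show "(r1, r2) \<otimes>\<^bsub>?S\<^esub> (r1, r2) \<oplus>\<^bsub>?S\<^esub> (Q, Q) = (P, P) \<otimes>\<^bsub>?S\<^esub> (r1, r2)"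
      by (simp add: P Q)
    show "\<psi> (a, b) \<in> carrier ?S" if "a \<in> carrier R" "b \<in> carrier R" for a b
      using mem[OF that] by simp
    show "\<psi> (a, b) \<oplus>\<^bsub>?S\<^esub> (b, b) \<otimes>\<^bsub>?S\<^esub> (r1, r2) = (a, a)" if "a \<in> carrier R" "b \<in> carrier R" for a b
      using that r by (simp add: \<psi>_def a_minus_def a_assoc l_neg)
  qed (rule PQ)+
  have inj: "inj_on \<psi> (carrier R \<times> carrier R)"
  proof (rule inj_onI, clarify)
    fix a b c e
    assume car: "a \<in> carrier R" "b \<in> carrier R" "c \<in> carrier R" "e \<in> carrier R"
      and "\<psi> (a, b) = \<psi> (c, e)"
    then have eq: "a \<ominus> b \<otimes> r1 = c \<ominus> e \<otimes> r1" "a \<ominus> b \<otimes> r2 = c \<ominus> e \<otimes> r2"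
      by (simp_all add: \<psi>_def)
    \<comment> \<open>Subtracting the two component equations eliminates a and c;
      \<open>r1 - r2\<close> is nonzero and cancels.\<close>
    have "(b \<ominus> e) \<otimes> ?d = ((a \<ominus> b \<otimes> r2) \<ominus> (c \<ominus> e \<otimes> r2)) \<ominus> ((a \<ominus> b \<otimes> r1) \<ominus> (c \<ominus> e \<otimes> r1))"
      using car r(1,2) by algebra
    also have "\<dots> = \<zero>"
      unfolding eq using car r(1,2) by algebra
    finally have be: "b = e"
      using integral[of "b \<ominus> e" ?d] d car by simp
    have "a = (a \<ominus> b \<otimes> r1) \<oplus> b \<otimes> r1"
      using car r(1) by algebra
    also have "\<dots> = (c \<ominus> b \<otimes> r1) \<oplus> b \<otimes> r1"
      using eq(1) unfolding be by (simp only:)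
    also have "\<dots> = c"
      using car r(1) by algebra
    finally show "a = c \<and> b = e"
      using be by simp
  qed
  have "(x, y) \<in> \<psi> ` (carrier R \<times> carrier R)" if H: "(x, y) \<in> ?H" for x y
  proof -
    obtain k where k: "k \<in> carrier R" "x \<ominus> y = k \<otimes> ?d" and xy: "x \<in> carrier R" "y \<in> carrier R"
      using H by (auto simp: congr)
    \<comment> \<open>With \<open>x - y = k (r1 - r2)\<close> the preimage must have second
      coordinate -k; the first component then fixes the first coordinate as
      \<open>x - k r1\<close>.\<close>
    have "x = (x \<ominus> k \<otimes> r1) \<ominus> \<ominus> k \<otimes> r1"
      using k(1) xy r(1) by algebra
    moreover have "y = (x \<ominus> k \<otimes> r1) \<ominus> \<ominus> k \<otimes> r2"
    proof -
      have "y = x \<ominus> (x \<ominus> y)"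
        using xy by algebra
      also have "\<dots> = (x \<ominus> k \<otimes> r1) \<ominus> \<ominus> k \<otimes> r2"
        unfolding k(2) using k(1) xy r(1,2) by algebra
      finally show ?thesis .
    qed
    ultimately have "(x, y) = \<psi> (x \<ominus> k \<otimes> r1, \<ominus> k)"
      by (simp add: \<psi>_def)
    then show ?thesis
      using k(1) xy r(1) by blast
  qed
  then have "?H \<subseteq> \<psi> ` (carrier R \<times> carrier R)"
    by (rule subrelI)
  moreover have "\<psi> ` (carrier R \<times> carrier R) \<subseteq> ?H"
  proof (rule image_subsetI)
    fix z assume "z \<in> carrier R \<times> carrier R"
    then show "\<psi> z \<in> ?H"
      using mem[of "fst z" "snd z"] by (simp only: mem_Times_iff prod.collapse)
  qed
  ultimately have "\<psi> ` (carrier R \<times> carrier R) = ?H"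
    by (rule equalityI[rotated])
  then have "bij_betw \<psi> (carrier R \<times> carrier R) (carrier ?S)"
    using inj by (simp add: bij_betw_def)
  from \<psi>_iso[OF this]
  show "algebra R (congr_pairs_alg R s)"
    and "\<psi> \<in> algebra_iso R (vec_alg R P Q) (congr_pairs_alg R s)"
    and "\<psi> \<in> iso (units_of (vec_alg R P Q)) (units_of (congr_pairs_alg R s))"
    by (simp_all add: congr_pairs_alg_def)
  \<comment> \<open>If d is a unit, so is its square root s, and every difference is a multiple of
    s.\<close>
  assume "discr R P Q \<in> Units R"
  then have "s \<otimes> s \<in> Units R"
    unfolding s(2)[symmetric] nat_pow_2[OF s(1)] .
  then have u: "s \<in> Units R"
    using s(1) Units_divide by blast
  have "congr_mod R s x y" if "x \<in> carrier R" "y \<in> carrier R" for x y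
    unfolding congr_mod_iff
    using that u s(1) by (intro bexI[of _ "(x \<ominus> y) \<otimes> inv s"]) (simp_all add: m_assoc)
  then show "carrier (congr_pairs_alg R s) = carrier R \<times> carrier R"
    by (auto simp: congr_pairs_alg_def)
qed

subsection \<open>Double roots\<close>

lemma (in domain) eps_sq_eq: "eps_sq R = quad_poly R \<zero> \<zero>"
proof -
  interpret UP: domain "poly_ring R"
    using univ_poly_is_domain[OF carrier_is_subring] .
  have "X \<in> carrier (poly_ring R)"
    using var_closed carrier_is_subring by blast
  then show ?thesis
    using poly_mult_var[OF carrier_is_subring, of X]
    by (simp add: eps_sq_def UP.nat_pow_2) (simp add: var_def quad_poly_def)
qed

lemma (in domain) poly_of_const_hom: "ring_hom_cring R (poly_ring R) poly_of_const"
  using canonical_embedding_ring_hom[OF carrier_is_subring] univ_poly_is_cring[OF carrier_is_subring]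
  by (simp add: ring_hom_cring_def ring_hom_cring_axioms_def ring_hom_ring_def ring_hom_ring_axioms_def cring_axioms)

text \<open>The map is the structure map for P = Q = 0 preceded by the shear \<open>(a1, a0)\<close>
  to \<open>(a1 - a0 \<theta>, a0)\<close>. The shear gives bijectivity; compatibility with products
  comes from \<open>\<epsilon> + \<theta>\<close> being a root of f in the dual numbers.\<close>

lemma (in domain) double_root_case:
  assumes \<theta>: "\<theta> \<in> carrier R" and P: "P = \<theta> \<oplus> \<theta>" and Q: "Q = \<theta> \<otimes> \<theta>"
  defines "\<psi> \<equiv> \<lambda>(a1, a0). residue_class R (eps_sq R)
     (poly_of_const a1 \<ominus>\<^bsub>poly_ring R\<^esub> poly_of_const a0 \<otimes>\<^bsub>poly_ring R\<^esub> (X \<oplus>\<^bsub>poly_ring R\<^esub> poly_of_const \<theta>))"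
  shows "algebra R (dual_numbers R)"
    and "\<psi> \<in> algebra_iso R (vec_alg R P Q) (dual_numbers R)"
    and "\<psi> \<in> iso (units_of (vec_alg R P Q)) (units_of (dual_numbers R))"
proof -
  let ?p = "quad_poly R \<zero> \<zero>"
  let ?S = "Rupt (carrier R) ?p"
  let ?h = "residue_class R ?p"
  let ?k = "\<lambda>r. ?h (poly_of_const r)"
  let ?\<phi> = "vec_to_order R \<zero> \<zero>"
  have p: "?p \<in> carrier (poly_ring R)"
    using quad_poly_closed by simp
  interpret UP: domain "poly_ring R"
    using univ_poly_is_domain[OF carrier_is_subring] .
  interpret h: ring_hom_ring "poly_ring R" ?S ?h
    using rupture_surj_hom(2)[OF carrier_is_subring p] by (simp add: residue_class_def[abs_def])
  interpret c: ring_hom_cring R "poly_ring R" poly_of_const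
    by (rule poly_of_const_hom)
  interpret D: quad_root R ?S ?k \<zero> \<zero> "?h X" ?\<phi>
    by (rule quad_root_vec_to_order) simp_all
  have X: "X \<in> carrier (poly_ring R)"
    using var_closed carrier_is_subring by blast
  have psi_eq: "\<psi> (a, b) = ?\<phi> (a \<ominus> b \<otimes> \<theta>, b)" if ab: "a \<in> carrier R" "b \<in> carrier R" for a b
  proof -
    let ?A = "poly_of_const a" and ?B = "poly_of_const b" and ?T = "poly_of_const \<theta>"
    have "?A \<in> carrier (poly_ring R)" "?B \<in> carrier (poly_ring R)" "?T \<in> carrier (poly_ring R)"
      using ab \<theta> by simp_all
    then have "?A \<ominus>\<^bsub>poly_ring R\<^esub> ?B \<otimes>\<^bsub>poly_ring R\<^esub> (X \<oplus>\<^bsub>poly_ring R\<^esub> ?T)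
        = (?A \<ominus>\<^bsub>poly_ring R\<^esub> ?B \<otimes>\<^bsub>poly_ring R\<^esub> ?T) \<ominus>\<^bsub>poly_ring R\<^esub> ?B \<otimes>\<^bsub>poly_ring R\<^esub> X"
      using X by algebra
    also have "?A \<ominus>\<^bsub>poly_ring R\<^esub> ?B \<otimes>\<^bsub>poly_ring R\<^esub> ?T = poly_of_const (a \<ominus> b \<otimes> \<theta>)"
      using ab \<theta> by (simp add: a_minus_def)
    finally show ?thesis
      by (simp add: \<psi>_def vec_to_order_def eps_sq_eq)
  qed
  have \<tau>: "?h X \<in> carrier ?S" "?k \<theta> \<in> carrier ?S"
    using X \<theta> by simp_all
  interpret quad_root R ?S ?k P Q "?h X \<oplus>\<^bsub>?S\<^esub> ?k \<theta>" \<psi>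
  proof
    show "P \<in> carrier R" "Q \<in> carrier R"
      using \<theta> P Q by simp_all
    show "?k \<in> ring_hom R ?S"
      by (rule D.k)
    show "?h X \<oplus>\<^bsub>?S\<^esub> ?k \<theta> \<in> carrier ?S"
      using \<tau> by simp
    have XX: "?h X \<otimes>\<^bsub>?S\<^esub> ?h X = \<zero>\<^bsub>?S\<^esub>"
      using D.\<tau>(2) \<tau> by simp
    \<comment> \<open>With \<open>\<tau> = \<epsilon> + \<theta>\<close>, this is
      \<open>(\<tau> - \<theta>)^2 = \<epsilon>^2\<close> expanded and arranged without subtraction;
      the right-hand square of \<epsilon> is zero.\<close>
    have "(?h X \<oplus>\<^bsub>?S\<^esub> ?k \<theta>) \<otimes>\<^bsub>?S\<^esub> (?h X \<oplus>\<^bsub>?S\<^esub> ?k \<theta>) \<oplus>\<^bsub>?S\<^esub> ?k \<theta> \<otimes>\<^bsub>?S\<^esub> ?k \<theta>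
        = ?h X \<otimes>\<^bsub>?S\<^esub> ?h X \<oplus>\<^bsub>?S\<^esub> (?k \<theta> \<oplus>\<^bsub>?S\<^esub> ?k \<theta>) \<otimes>\<^bsub>?S\<^esub> (?h X \<oplus>\<^bsub>?S\<^esub> ?k \<theta>)"
      using \<tau> by algebra
    then show "(?h X \<oplus>\<^bsub>?S\<^esub> ?k \<theta>) \<otimes>\<^bsub>?S\<^esub> (?h X \<oplus>\<^bsub>?S\<^esub> ?k \<theta>) \<oplus>\<^bsub>?S\<^esub> ?k Q = ?k P \<otimes>\<^bsub>?S\<^esub> (?h X \<oplus>\<^bsub>?S\<^esub> ?k \<theta>)"
      using \<tau> \<theta> by (simp add: XX P Q)
    fix a b assume ab: "a \<in> carrier R" "b \<in> carrier R"
    have c: "a \<ominus> b \<otimes> \<theta> \<in> carrier R"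
      using ab \<theta> by simp
    show "\<psi> (a, b) \<in> carrier ?S"
      using D.\<psi>(1)[OF c ab(2)] psi_eq[OF ab] by simp
    have "\<psi> (a, b) \<oplus>\<^bsub>?S\<^esub> ?k b \<otimes>\<^bsub>?S\<^esub> (?h X \<oplus>\<^bsub>?S\<^esub> ?k \<theta>)
        = (?\<phi> (a \<ominus> b \<otimes> \<theta>, b) \<oplus>\<^bsub>?S\<^esub> ?k b \<otimes>\<^bsub>?S\<^esub> ?h X) \<oplus>\<^bsub>?S\<^esub> ?k b \<otimes>\<^bsub>?S\<^esub> ?k \<theta>"
      unfolding psi_eq[OF ab] using D.\<psi>(1)[OF c ab(2)] \<tau> D.k.hom_closed[OF ab(2)] by algebra
    also have "\<dots> = ?k a \<ominus>\<^bsub>?S\<^esub> ?k b \<otimes>\<^bsub>?S\<^esub> ?k \<theta> \<oplus>\<^bsub>?S\<^esub> ?k b \<otimes>\<^bsub>?S\<^esub> ?k \<theta>"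
      unfolding D.\<psi>(2)[OF c ab(2)] using ab \<theta> by (simp add: D.k_minus a_minus_def)
    also have "\<dots> = ?k a"
      using D.k.hom_closed[OF ab(1)] D.k.hom_closed[OF ab(2)] \<tau>(2) by algebra
    finally show "\<psi> (a, b) \<oplus>\<^bsub>?S\<^esub> ?k b \<otimes>\<^bsub>?S\<^esub> (?h X \<oplus>\<^bsub>?S\<^esub> ?k \<theta>) = ?k a" .
  qed
  have "bij_betw (\<lambda>(a, b). (a \<ominus> b \<otimes> \<theta>, b)) (carrier R \<times> carrier R) (carrier R \<times> carrier R)"
  proof (rule bij_betw_byWitness[where f' = "\<lambda>(a, b). (a \<oplus> b \<otimes> \<theta>, b)"])
    have "a \<ominus> b \<otimes> \<theta> \<oplus> b \<otimes> \<theta> = a" "a \<oplus> b \<otimes> \<theta> \<ominus> b \<otimes> \<theta> = a" if "a \<in> carrier R" "b \<in> carrier R" for a b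
      using that \<theta> by algebra+
    then show "\<forall>z\<in>carrier R \<times> carrier R. (\<lambda>(a, b). (a \<oplus> b \<otimes> \<theta>, b)) ((\<lambda>(a, b). (a \<ominus> b \<otimes> \<theta>, b)) z) = z"
      "\<forall>z\<in>carrier R \<times> carrier R. (\<lambda>(a, b). (a \<ominus> b \<otimes> \<theta>, b)) ((\<lambda>(a, b). (a \<oplus> b \<otimes> \<theta>, b)) z) = z"
      by auto
  qed (use \<theta> in auto)
  from bij_betw_trans[OF this vec_to_order_bij_betw[of \<zero> \<zero>]]
  have "bij_betw (?\<phi> \<circ> (\<lambda>(a, b). (a \<ominus> b \<otimes> \<theta>, b))) (carrier R \<times> carrier R) (carrier ?S)"
    by (simp add: order_alg_def residue_algebra_def)
  moreover have "\<psi> z = (?\<phi> \<circ> (\<lambda>(a, b). (a \<ominus> b \<otimes> \<theta>, b))) z" if "z \<in> carrier R \<times> carrier R" for z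
    using that psi_eq by (cases z) simp
  ultimately have "bij_betw \<psi> (carrier R \<times> carrier R) (carrier ?S)"
    using bij_betw_cong by blast
  from \<psi>_iso[OF this]
  show "algebra R (dual_numbers R)"
    and "\<psi> \<in> algebra_iso R (vec_alg R P Q) (dual_numbers R)"
    and "\<psi> \<in> iso (units_of (vec_alg R P Q)) (units_of (dual_numbers R))"
    by (simp_all add: dual_numbers_def residue_algebra_def eps_sq_eq)
qed

text \<open>For P = Q = 0 the norm of \<open>(x, y)\<close> is \<open>x x\<close>, which is a unit
  exactly when x is. The structure map carries these pairs to the dual numbers.\<close>

lemma (in domain) Units_dual_numbers:
  "Units (dual_numbers R) =
    {residue_class R (eps_sq R) (poly_of_const x \<oplus>\<^bsub>poly_ring R\<^esub> poly_of_const y \<otimes>\<^bsub>poly_ring R\<^esub> X) | x y.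
     x \<in> Units R \<and> y \<in> carrier R}" (is "_ = ?U")
proof -
  interpret UP: domain "poly_ring R"
    using univ_poly_is_domain[OF carrier_is_subring] .
  interpret c: ring_hom_cring R "poly_ring R" poly_of_const
    by (rule poly_of_const_hom)
  have X: "X \<in> carrier (poly_ring R)"
    using var_closed carrier_is_subring by blast
  have alg: "algebra R (vec_alg R \<zero> \<zero>)" "algebra R (order_alg R \<zero> \<zero>)"
    by (simp_all add: algebra_vec_alg algebra_order_alg)
  have "x \<otimes> x \<in> Units R \<longleftrightarrow> x \<in> Units R" if "x \<in> carrier R" for x
    using that Units_divide[of x x] by auto
  then have U: "Units (vec_alg R \<zero> \<zero>) = Units R \<times> carrier R"
    by (auto simp: Units_vec_alg nat_pow_2 a_minus_def Units_closed)
  have "Units (dual_numbers R) = vec_to_order R \<zero> \<zero> ` Units (vec_alg R \<zero> \<zero>)"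
    using ring_iso_image_Units[OF cring.axioms(1)[OF algebra.M_cring[OF alg(1)]]
        cring.axioms(1)[OF algebra.M_cring[OF alg(2)]], of "vec_to_order R \<zero> \<zero>"]
      vec_to_order_iso[of \<zero> \<zero>]
    by (simp add: algebra_iso_def dual_numbers_def order_alg_def eps_sq_eq)
  also have "\<dots> = ?U"
  proof -
    \<comment> \<open>The sign change passes from the encoding \<open>a1 - a0 t\<close> to the form
      \<open>x + y \<epsilon>\<close>; it permutes R, so y still ranges over all of R.\<close>
    have eq: "vec_to_order R \<zero> \<zero> (x, \<ominus> y) = residue_class R (eps_sq R)
        (poly_of_const x \<oplus>\<^bsub>poly_ring R\<^esub> poly_of_const y \<otimes>\<^bsub>poly_ring R\<^esub> X)"
      if "x \<in> carrier R" "y \<in> carrier R" for x y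
    proof -
      have "poly_of_const x \<ominus>\<^bsub>poly_ring R\<^esub> poly_of_const (\<ominus> y) \<otimes>\<^bsub>poly_ring R\<^esub> X
          = poly_of_const x \<oplus>\<^bsub>poly_ring R\<^esub> poly_of_const y \<otimes>\<^bsub>poly_ring R\<^esub> X"
        using that X by (simp add: a_minus_def UP.l_minus)
      then show ?thesis
        by (simp only: vec_to_order_def eps_sq_eq prod.case)
    qed
    show ?thesis
      unfolding U
    proof (intro equalityI subsetI)
      fix z assume "z \<in> vec_to_order R \<zero> \<zero> ` (Units R \<times> carrier R)"
      then obtain x y where xy: "x \<in> Units R" "y \<in> carrier R" and z: "z = vec_to_order R \<zero> \<zero> (x, y)"
        by blast
      have "z = residue_class R (eps_sq R)
          (poly_of_const x \<oplus>\<^bsub>poly_ring R\<^esub> poly_of_const (\<ominus> y) \<otimes>\<^bsub>poly_ring R\<^esub> X)"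
        unfolding z eq[OF Units_closed[OF xy(1)] a_inv_closed[OF xy(2)], symmetric] minus_minus[OF xy(2)] ..
      then show "z \<in> ?U"
        using xy by blast
    next
      fix z assume "z \<in> ?U"
      then obtain x y where xy: "x \<in> Units R" "y \<in> carrier R"
        and "z = residue_class R (eps_sq R) (poly_of_const x \<oplus>\<^bsub>poly_ring R\<^esub> poly_of_const y \<otimes>\<^bsub>poly_ring R\<^esub> X)"
        by blast
      then have "z = vec_to_order R \<zero> \<zero> (x, \<ominus> y)"
        using eq[OF Units_closed[OF xy(1)] xy(2)] by (simp only:)
      then show "z \<in> vec_to_order R \<zero> \<zero> ` (Units R \<times> carrier R)"
        using xy by blast
    qed
  qed
  finally show ?thesis .
qed

section \<open>Assembly of the general statements and the three cases\<close>

theorem theorem4: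
  fixes R :: "('a, 'm) ring_scheme" and L :: "('b, 'n) ring_scheme"
    and \<iota> :: "'a \<Rightarrow> 'b" and P Q :: 'a and \<theta>1 \<theta>2 :: 'b
  assumes "factorial_domain R"
    and "P \<in> carrier R" and "Q \<in> Units R"
    and "alg_closure_of_fractions R L \<iota>"
    and "ring.roots L (map \<iota> (quad_poly R P Q)) = {#\<theta>1, \<theta>2#}"
  shows
    "(algebra R (order_alg R P Q) \<and> algebra R (vec_alg R P Q) \<and>
      vec_to_order R P Q \<in> algebra_iso R (vec_alg R P Q) (order_alg R P Q) \<and>
      Units (vec_alg R P Q) =
        {(a1, a0) \<in> carrier R \<times> carrier R.
          a1 [^]\<^bsub>R\<^esub> (2::nat) \<ominus>\<^bsub>R\<^esub> P \<otimes>\<^bsub>R\<^esub> a0 \<otimes>\<^bsub>R\<^esub> a1 \<oplus>\<^bsub>R\<^esub> Q \<otimes>\<^bsub>R\<^esub> a0 [^]\<^bsub>R\<^esub> (2::nat) \<in> Units R} \<and>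
      group (unit_seq_group R P Q) \<and>
      seq_init \<in> iso (unit_seq_group R P Q) (units_of (vec_alg R P Q)))
     \<and>
     (pirreducible\<^bsub>R\<^esub> (carrier R) (quad_poly R P Q) \<longrightarrow>
      (let \<psi> = (\<lambda>(a1, a0). \<iota> a1 \<ominus>\<^bsub>L\<^esub> \<iota> a0 \<otimes>\<^bsub>L\<^esub> \<theta>1) in
        algebra R (adjoin R L \<iota> \<theta>1) \<and>
        \<psi> \<in> algebra_iso R (vec_alg R P Q) (adjoin R L \<iota> \<theta>1) \<and>
        \<psi> \<in> iso (units_of (vec_alg R P Q)) (units_of (adjoin R L \<iota> \<theta>1))))
     \<and>
     (\<not> pirreducible\<^bsub>R\<^esub> (carrier R) (quad_poly R P Q) \<longrightarrow>
      (\<exists>s\<in>carrier R. s [^]\<^bsub>R\<^esub> (2::nat) = discr R P Q) \<and>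
      (\<not> (\<exists>\<theta>. double_root R (quad_poly R P Q) \<theta>) \<longrightarrow>
        (\<exists>r1\<in>carrier R. \<exists>r2\<in>carrier R. \<iota> r1 = \<theta>1 \<and> \<iota> r2 = \<theta>2 \<and>
          (r1 \<ominus>\<^bsub>R\<^esub> r2) [^]\<^bsub>R\<^esub> (2::nat) = discr R P Q \<and>
          (\<forall>s\<in>carrier R. s [^]\<^bsub>R\<^esub> (2::nat) = discr R P Q \<longrightarrow>
            (let \<psi> = (\<lambda>(a1, a0). (a1 \<ominus>\<^bsub>R\<^esub> a0 \<otimes>\<^bsub>R\<^esub> r1, a1 \<ominus>\<^bsub>R\<^esub> a0 \<otimes>\<^bsub>R\<^esub> r2)) in
              algebra R (congr_pairs_alg R s) \<and>
              (discr R P Q \<in> Units R \<longrightarrow>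
                carrier (congr_pairs_alg R s) = carrier R \<times> carrier R) \<and>
              \<psi> \<in> algebra_iso R (vec_alg R P Q) (congr_pairs_alg R s) \<and>
              \<psi> \<in> iso (units_of (vec_alg R P Q)) (units_of (congr_pairs_alg R s)) \<and>
              Units (congr_pairs_alg R s) =
                {(x, y) \<in> Units R \<times> Units R. congr_mod R s x y})))) \<and>
      (\<forall>\<theta>. double_root R (quad_poly R P Q) \<theta> \<longrightarrow>
        (let \<psi> = (\<lambda>(a1, a0). residue_class R (eps_sq R)
               (ring.poly_of_const R a1 \<ominus>\<^bsub>poly_ring R\<^esub>
                ring.poly_of_const R a0 \<otimes>\<^bsub>poly_ring R\<^esub>
                  (X\<^bsub>R\<^esub> \<oplus>\<^bsub>poly_ring R\<^esub> ring.poly_of_const R \<theta>))) in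
          algebra R (dual_numbers R) \<and>
          \<psi> \<in> algebra_iso R (vec_alg R P Q) (dual_numbers R) \<and>
          \<psi> \<in> iso (units_of (vec_alg R P Q)) (units_of (dual_numbers R)) \<and>
          Units (dual_numbers R) =
            {residue_class R (eps_sq R)
               (ring.poly_of_const R x \<oplus>\<^bsub>poly_ring R\<^esub>
                ring.poly_of_const R y \<otimes>\<^bsub>poly_ring R\<^esub> X\<^bsub>R\<^esub>) | x y.
             x \<in> Units R \<and> y \<in> carrier R})))"
proof -
  interpret R: factorial_domain R by fact
  have \<iota>: "\<iota> \<in> ring_hom R L" "inj_on \<iota> (carrier R)" and clos: "algebraic_closure L (fractions_in R L \<iota>)"
    using assms(4) by (simp_all add: alg_closure_of_fractions_def)
  interpret L: field L
    using clos by (rule algebraic_closure.axioms(1))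
  interpret \<iota>: ring_hom_cring R L \<iota>
    by unfold_locales (rule \<iota>(1))
  note P = assms(2)
  have Q: "Q \<in> carrier R"
    using assms(3) by (rule R.Units_closed)
  have "map \<iota> (quad_poly R P Q) = quad_poly L (\<iota> P) (\<iota> Q)"
    using P by (simp add: quad_poly_def)
  \<comment> \<open>The mapped polynomial is the quadratic over L with coefficients from the images
    of P and Q, so the given multiset of roots yields Vieta's relations.\<close>
  note roots = L.roots_quad_poly[OF \<iota>.hom_closed[OF P] \<iota>.hom_closed[OF Q], of \<theta>1 \<theta>2,
      folded this, OF assms(5)]
  interpret quad_roots_field R L \<iota> P Q \<theta>1 \<theta>2
    by unfold_locales (rule \<iota> P Q roots)+
  have reducible: "\<exists>s\<in>carrier R. s [^]\<^bsub>R\<^esub> (2::nat) = discr R P Q"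
    if red: "\<not> pirreducible\<^bsub>R\<^esub> (carrier R) (quad_poly R P Q)"
  proof -
    obtain r1 r2 where r: "r1 \<in> carrier R" "r2 \<in> carrier R" "r1 \<oplus>\<^bsub>R\<^esub> r2 = P" "r1 \<otimes>\<^bsub>R\<^esub> r2 = Q"
      using reducible_roots[OF red] by blast
    then show ?thesis
      using R.discr_eq[OF r(1,2)] by (intro bexI[of _ "r1 \<ominus>\<^bsub>R\<^esub> r2"]) simp_all
  qed
  have distinct: "\<exists>r1\<in>carrier R. \<exists>r2\<in>carrier R. \<iota> r1 = \<theta>1 \<and> \<iota> r2 = \<theta>2 \<and>
      (r1 \<ominus>\<^bsub>R\<^esub> r2) [^]\<^bsub>R\<^esub> (2::nat) = discr R P Q \<and>
      (\<forall>s\<in>carrier R. s [^]\<^bsub>R\<^esub> (2::nat) = discr R P Q \<longrightarrow>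
        (let \<psi> = (\<lambda>(a1, a0). (a1 \<ominus>\<^bsub>R\<^esub> a0 \<otimes>\<^bsub>R\<^esub> r1, a1 \<ominus>\<^bsub>R\<^esub> a0 \<otimes>\<^bsub>R\<^esub> r2)) in
          algebra R (congr_pairs_alg R s) \<and>
          (discr R P Q \<in> Units R \<longrightarrow>
            carrier (congr_pairs_alg R s) = carrier R \<times> carrier R) \<and>
          \<psi> \<in> algebra_iso R (vec_alg R P Q) (congr_pairs_alg R s) \<and>
          \<psi> \<in> iso (units_of (vec_alg R P Q)) (units_of (congr_pairs_alg R s)) \<and>
          Units (congr_pairs_alg R s) =
            {(x, y) \<in> Units R \<times> Units R. congr_mod R s x y}))"
    if red: "\<not> pirreducible\<^bsub>R\<^esub> (carrier R) (quad_poly R P Q)"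
      and no_double: "\<not> (\<exists>\<theta>. double_root R (quad_poly R P Q) \<theta>)"
  proof -
    obtain r1 r2 where r: "r1 \<in> carrier R" "r2 \<in> carrier R" "\<iota> r1 = \<theta>1" "\<iota> r2 = \<theta>2"
        and PQr: "r1 \<oplus>\<^bsub>R\<^esub> r2 = P" "r1 \<otimes>\<^bsub>R\<^esub> r2 = Q"
      using reducible_roots[OF red] by blast
    \<comment> \<open>If r1 and r2 coincided, P would be twice and Q the square of that element,
      making it a double root.\<close>
    have ne: "r1 \<noteq> r2"
      using no_double R.double_root_quad_poly_iff[OF P Q] r(1) PQr by blast
    have d: "(r1 \<ominus>\<^bsub>R\<^esub> r2) [^]\<^bsub>R\<^esub> (2::nat) = discr R P Q"
      using R.discr_eq[OF r(1,2)] PQr by simp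
    show ?thesis
      unfolding Let_def
      by (intro bexI[OF _ r(1)] bexI[OF _ r(2)] conjI ballI impI r(3,4) d
          R.distinct_roots_case[OF r(1,2) ne PQr] R.Units_congr_pairs_alg)
  qed
  have double: "let \<psi> = (\<lambda>(a1, a0). residue_class R (eps_sq R)
         (ring.poly_of_const R a1 \<ominus>\<^bsub>poly_ring R\<^esub>
          ring.poly_of_const R a0 \<otimes>\<^bsub>poly_ring R\<^esub>
            (X\<^bsub>R\<^esub> \<oplus>\<^bsub>poly_ring R\<^esub> ring.poly_of_const R \<theta>))) in
      algebra R (dual_numbers R) \<and>
      \<psi> \<in> algebra_iso R (vec_alg R P Q) (dual_numbers R) \<and>
      \<psi> \<in> iso (units_of (vec_alg R P Q)) (units_of (dual_numbers R)) \<and>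
      Units (dual_numbers R) =
        {residue_class R (eps_sq R)
           (ring.poly_of_const R x \<oplus>\<^bsub>poly_ring R\<^esub>
            ring.poly_of_const R y \<otimes>\<^bsub>poly_ring R\<^esub> X\<^bsub>R\<^esub>) | x y.
         x \<in> Units R \<and> y \<in> carrier R}"
    if "double_root R (quad_poly R P Q) \<theta>" for \<theta>
  proof -
    have \<theta>: "\<theta> \<in> carrier R" "P = \<theta> \<oplus>\<^bsub>R\<^esub> \<theta>" "Q = \<theta> \<otimes>\<^bsub>R\<^esub> \<theta>"
      using that R.double_root_quad_poly_iff[OF P Q] by blast+
    show ?thesis
      unfolding Let_def
      by (intro conjI R.double_root_case[OF \<theta>] R.Units_dual_numbers)
  qed
  show ?thesis
    using R.algebra_order_alg[OF P Q] R.algebra_vec_alg[OF P Q] R.vec_to_order_iso[OF P Q]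
      R.Units_vec_alg[OF P Q] R.unit_seq_group[OF P assms(3)]
      irreducible_case reducible distinct double
    unfolding Let_def by blast
qed

end
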